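(* Let $\mathfrak{h}$ be a $d$-dimensional complex vector space with a nondegenerate symmetric bilinear form $\langle\cdot,\cdot\rangle$, let $0\neq h\in\mathfrak{h}$ with $\langle h,h\rangle=0$, and let $G=\mathrm{Aut}(V_{\widehat{\mathfrak{h}}}(1,0),\omega_h)$. Then the orbits of $\mathrm{Reg}(\mathfrak{h})_h$ under the action of $G$ are the following (each set consisting of elements of $\mathrm{Reg}(\mathfrak{h})_h$): 1) $J_1(k)=\{(\mathfrak{h}',h)\mid\dim\mathfrak{h}'=k\}$ for $k=2,\dots,d$; 2) $J_2(k)=\{(\mathfrak{h}',0)\mid\dim\mathfrak{h}'=k\}$ for $k=0,1,\dots,d-2$; 3) for each $y\in\mathbb{C}$ with $y\neq0$: $J_3(k,y)=\{(\mathfrak{h}',h')\mid\dim\mathfrak{h}'=k,\ \langle h',h'\rangle=y\}$ for $k=1,\dots,d-1$; 4) $J_4(k,0)=\{(\mathfrak{h}',h')\mid\dim\mathfrak{h}'=k,\ \langle h',h'\rangle=0,\ h'\neq0,h\}$ for $k=2,\dots,d-2$. That is, $$\mathrm{Reg}(\mathfrak{h})_h=\bigcup_{k=2}^{d}J_1(k)\cup\bigcup_{k=0}^{d-2}J_2(k)\cup\bigcup_{k=1}^{d-1}\Big(\bigcup_{y\neq0}J_3(k,y)\Big)\cup\bigcup_{k=2}^{d-2}J_4(k,0).$$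
   Context: Everything is over $\mathbb{C}$. A subspace $\mathfrak{h}'\subseteq\mathfrak{h}$ (possibly $0$) is regular if $\langle\cdot,\cdot\rangle|_{\mathfrak{h}'}$ is nondegenerate; then $\mathfrak{h}=\mathfrak{h}'\oplus\mathfrak{h}'^{\perp}$ and $P_{\mathfrak{h}'}:\mathfrak{h}\to\mathfrak{h}'$ is the projection. $\mathrm{Reg}(\mathfrak{h})_h=\{(\mathfrak{h}',h')\mid\mathfrak{h}'\text{ a regular subspace of }\mathfrak{h},\ h'=P_{\mathfrak{h}'}(h)\}$. $\widehat{\mathfrak{h}}=\mathbb{C}[t,t^{-1}]\otimes\mathfrak{h}\oplus\mathbb{C}C$ is the Lie algebra with $C$ central and $[u\otimes t^m,v\otimes t^n]=m\langle u,v\rangle\delta_{m,-n}C$. $V_{\widehat{\mathfrak{h}}}(1,0)=U(\widehat{\mathfrak{h}})\otimes_{U(\widehat{\mathfrak{h}}^{\geq 0})}\mathbb{C}\mathbf{1}$, where $\widehat{\mathfrak{h}}^{\ge 0}=\mathbb{C}[t]\otimes\mathfrak{h}\oplus\mathbb{C}C$ acts on $\mathbb{C}\mathbf{1}$ with $\mathbb{C}[t]\otimes\mathfrak{h}$ acting by $0$ and $C$ by $1$; $u(n)$ is the action of $u\otimes t^n$; it is a vertex algebra with vacuum $\mathbf{1}$ and $Y(u(-1)\mathbf{1},z)=\sum_{n}u(n)z^{-n-1}$. For an orthonormal basis $h_1,\dots,h_d$, $\omega_h=\frac12\sum_i h_i(-1)^2\mathbf{1}+h(-2)\mathbf{1}$,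 a conformal vector. $G$ is the group of vertex algebra automorphisms of $V_{\widehat{\mathfrak{h}}}(1,0)$ fixing $\omega_h$; identifying $\mathfrak{h}$ with the weight-one subspace via $u\mapsto u(-1)\mathbf{1}$, restriction to $\mathfrak{h}$ identifies $G$ with $\{\sigma\in\mathrm{O}(\mathfrak{h})\mid\sigma(h)=h\}$, and $G$ acts on $\mathrm{Reg}(\mathfrak{h})_h$ by $\sigma\cdot(\mathfrak{h}',h')=(\sigma(\mathfrak{h}'),\sigma(h'))$. *)

theory Defs
  imports
    Complex_Main
    "HOL-Library.Poly_Mapping"
    "HOL-Library.Product_Plus"
    "HOL-Algebra.Group_Action"
begin

section \<open>Regular subspaces\<close>

locale quadratic_space = vector_space scale
  for scale :: "complex \<Rightarrow> 'h::ab_group_add \<Rightarrow> 'h" +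
  fixes form :: "'h \<Rightarrow> 'h \<Rightarrow> complex"
  assumes finite_dim: "\<exists>B. finite B \<and> span B = UNIV"
    and form_linear: "Vector_Spaces.linear scale (*) (form u)"
    and form_sym: "form u v = form v u"
    and form_nondegenerate: "(\<And>v. form u v = 0) \<Longrightarrow> u = 0"

definition orthonormal_basis ::
  "(complex \<Rightarrow> 'h::ab_group_add \<Rightarrow> 'h) \<Rightarrow> ('h \<Rightarrow> 'h \<Rightarrow> complex) \<Rightarrow> 'h set \<Rightarrow> bool" where
  "orthonormal_basis scale form E \<longleftrightarrow>
     finite E \<and> \<not> module.dependent scale E \<and> module.span scale E = UNIV \<and>
     (\<forall>e\<in>E. \<forall>e'\<in>E. form e e' = (if e = e' then 1 else 0))"

definition regular_subspace ::
  "(complex \<Rightarrow> 'h::ab_group_add \<Rightarrow> 'h) \<Rightarrow> ('h \<Rightarrow> 'h \<Rightarrow> complex) \<Rightarrow> 'h set \<Rightarrow> bool" where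
  "regular_subspace scale form W \<longleftrightarrow>
     module.subspace scale W \<and> (\<forall>u\<in>W. (\<forall>v\<in>W. form u v = 0) \<longrightarrow> u = 0)"

text \<open>The projection onto \<open>W\<close> along its orthogonal complement; meaningful for regular \<open>W\<close>.\<close>

definition orth_proj :: "('h::ab_group_add \<Rightarrow> 'h \<Rightarrow> complex) \<Rightarrow> 'h set \<Rightarrow> 'h \<Rightarrow> 'h" where
  "orth_proj form W v = (THE w. w \<in> W \<and> (\<forall>u\<in>W. form (v - w) u = 0))"

definition Reg ::
  "(complex \<Rightarrow> 'h::ab_group_add \<Rightarrow> 'h) \<Rightarrow> ('h \<Rightarrow> 'h \<Rightarrow> complex) \<Rightarrow> 'h \<Rightarrow> ('h set \<times> 'h) set" where
  "Reg scale form h = {(W, w). regular_subspace scale form W \<and> w = orth_proj form W h}"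

definition J1 ::
  "(complex \<Rightarrow> 'h::ab_group_add \<Rightarrow> 'h) \<Rightarrow> ('h \<Rightarrow> 'h \<Rightarrow> complex) \<Rightarrow> 'h \<Rightarrow> nat \<Rightarrow> ('h set \<times> 'h) set" where
  "J1 scale form h k = {(W, w) \<in> Reg scale form h. vector_space.dim scale W = k \<and> w = h}"

definition J2 ::
  "(complex \<Rightarrow> 'h::ab_group_add \<Rightarrow> 'h) \<Rightarrow> ('h \<Rightarrow> 'h \<Rightarrow> complex) \<Rightarrow> 'h \<Rightarrow> nat \<Rightarrow> ('h set \<times> 'h) set" where
  "J2 scale form h k = {(W, w) \<in> Reg scale form h. vector_space.dim scale W = k \<and> w = 0}"

definition J3 ::
  "(complex \<Rightarrow> 'h::ab_group_add \<Rightarrow> 'h) \<Rightarrow> ('h \<Rightarrow> 'h \<Rightarrow> complex) \<Rightarrow> 'h \<Rightarrow> nat \<Rightarrow> complex \<Rightarrow>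
    ('h set \<times> 'h) set" where
  "J3 scale form h k y =
     {(W, w) \<in> Reg scale form h. vector_space.dim scale W = k \<and> form w w = y}"

definition J4 ::
  "(complex \<Rightarrow> 'h::ab_group_add \<Rightarrow> 'h) \<Rightarrow> ('h \<Rightarrow> 'h \<Rightarrow> complex) \<Rightarrow> 'h \<Rightarrow> nat \<Rightarrow> ('h set \<times> 'h) set" where
  "J4 scale form h k =
     {(W, w) \<in> Reg scale form h.
        vector_space.dim scale W = k \<and> form w w = 0 \<and> w \<noteq> 0 \<and> w \<noteq> h}"


section \<open>Modules induced from a one-dimensional module\<close>

text \<open>
  For a complex Lie algebra on the type \<open>'g\<close>, the tensor algebra is presented as the free
  associative algebra on the underlying set of \<open>'g\<close> (linear combinations of words in \<open>'g\<close>)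
  modulo the linearity relations. Together with the commutator relations they generate the
  two-sided ideal whose quotient is the universal enveloping algebra.
\<close>

type_synonym 'g free_alg = "'g list \<Rightarrow>\<^sub>0 complex"

definition free_scale :: "complex \<Rightarrow> 'g free_alg \<Rightarrow> 'g free_alg" where
  "free_scale c = Poly_Mapping.map ((*) c)"

definition word :: "'g list \<Rightarrow> 'g free_alg" where
  "word xs = Poly_Mapping.single xs 1"

definition uea_relations ::
  "(complex \<Rightarrow> 'g::ab_group_add \<Rightarrow> 'g) \<Rightarrow> ('g \<Rightarrow> 'g \<Rightarrow> 'g) \<Rightarrow> 'g free_alg set" where
  "uea_relations gscale bracket =
     {word (xs @ [x + y] @ ys) - word (xs @ [x] @ ys) - word (xs @ [y] @ ys) | xs x y ys. True} \<union>
     {word (xs @ [gscale c x] @ ys) - free_scale c (word (xs @ [x] @ ys)) | xs c x ys. True} \<union>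
     {word (xs @ [x, y] @ ys) - word (xs @ [y, x] @ ys) - word (xs @ [bracket x y] @ ys)
        | xs x y ys. True}"

text \<open>
  For a character \<open>chi\<close> of a subalgebra \<open>P\<close>, the relations \<open>u p \<otimes> 1 = chi(p) (u \<otimes> 1)\<close> of the
  tensor product \<open>U(g) \<otimes>\<^bsub>U(P)\<^esub> \<complex>\<close>, for \<open>u\<close> and \<open>p\<close> running over the words \<open>us\<close> in \<open>g\<close> and
  \<open>ps\<close> in \<open>P\<close>, which span \<open>U(g)\<close> and \<open>U(P)\<close>.
\<close>

definition tensor_relations :: "'g set \<Rightarrow> ('g \<Rightarrow> complex) \<Rightarrow> 'g free_alg set" where
  "tensor_relations P chi =
     {word (us @ ps) - free_scale (prod_list (map chi ps)) (word us) | us ps. set ps \<subseteq> P}"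

definition word_action ::
  "(complex \<Rightarrow> 'v::ab_group_add \<Rightarrow> 'v) \<Rightarrow> ('g \<Rightarrow> 'v \<Rightarrow> 'v) \<Rightarrow> 'v \<Rightarrow> 'g free_alg \<Rightarrow> 'v" where
  "word_action vscale act v0 p =
     (\<Sum>xs\<in>Poly_Mapping.keys p. vscale (Poly_Mapping.lookup p xs) (foldr act xs v0))"

text \<open>
  The module \<open>V\<close> with vector \<open>v0\<close> is (isomorphic to) \<open>U(g) \<otimes>\<^bsub>U(P)\<^esub> \<complex>\<close> with vector \<open>1 \<otimes> 1\<close>:
  sending a word to its action on \<open>v0\<close> is onto, and its kernel is spanned by the relations above.
\<close>

definition induced_module ::
  "(complex \<Rightarrow> 'g::ab_group_add \<Rightarrow> 'g) \<Rightarrow> ('g \<Rightarrow> 'g \<Rightarrow> 'g) \<Rightarrow> 'g set \<Rightarrow> ('g \<Rightarrow> complex) \<Rightarrow>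
   (complex \<Rightarrow> 'v::ab_group_add \<Rightarrow> 'v) \<Rightarrow> ('g \<Rightarrow> 'v \<Rightarrow> 'v) \<Rightarrow> 'v \<Rightarrow> bool" where
  "induced_module gscale bracket P chi vscale act v0 \<longleftrightarrow>
     (\<forall>x. Vector_Spaces.linear vscale vscale (act x)) \<and>
     (\<forall>v. Vector_Spaces.linear gscale vscale (\<lambda>x. act x v)) \<and>
     (\<forall>x y v. act (bracket x y) v = act x (act y v) - act y (act x v)) \<and>
     surj (word_action vscale act v0) \<and>
     {p. word_action vscale act v0 p = 0} =
       module.span free_scale (uea_relations gscale bracket \<union> tensor_relations P chi)"


section \<open>The Heisenberg Lie algebra\<close>

text \<open>
  \<open>(f, c)\<close> stands for \<open>(\<Sum>n. f(n) \<otimes> t\<^sup>n) + c C\<close>, where \<open>f\<close> is finitely supported on the integers.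
\<close>

type_synonym 'h heis = "(int \<Rightarrow>\<^sub>0 'h) \<times> complex"

definition heis_scale ::
  "(complex \<Rightarrow> 'h::ab_group_add \<Rightarrow> 'h) \<Rightarrow> complex \<Rightarrow> 'h heis \<Rightarrow> 'h heis" where
  "heis_scale scale c x = (Poly_Mapping.map (scale c) (fst x), c * snd x)"

definition heis_bracket ::
  "('h::ab_group_add \<Rightarrow> 'h \<Rightarrow> complex) \<Rightarrow> 'h heis \<Rightarrow> 'h heis \<Rightarrow> 'h heis" where
  "heis_bracket form x y =
     (0, \<Sum>m\<in>Poly_Mapping.keys (fst x).
           of_int m * form (Poly_Mapping.lookup (fst x) m) (Poly_Mapping.lookup (fst y) (- m)))"

definition heis_nonneg :: "'h::ab_group_add heis set" where
  "heis_nonneg = {x. \<forall>n<0. Poly_Mapping.lookup (fst x) n = 0}"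

definition loop :: "'h::ab_group_add \<Rightarrow> int \<Rightarrow> 'h heis" where
  "loop u n = (Poly_Mapping.single n u, 0)"


section \<open>Vertex algebras\<close>

text \<open>
  \<open>nprod a n b\<close> is the mode \<open>a\<^sub>n b\<close>, where \<open>Y(a,z) = \<Sum>n. a\<^sub>n z\<^bsup>-n-1\<^esup>\<close>; the last axiom is the
  Jacobi identity in modes. Both of its sums are finite because of truncation.
\<close>

locale vertex_algebra = vector_space vscale
  for vscale :: "complex \<Rightarrow> 'v::ab_group_add \<Rightarrow> 'v" +
  fixes vac :: 'v
    and nprod :: "'v \<Rightarrow> int \<Rightarrow> 'v \<Rightarrow> 'v"
  assumes linear_left: "Vector_Spaces.linear vscale vscale (\<lambda>a. nprod a n b)"
    and linear_right: "Vector_Spaces.linear vscale vscale (nprod a n)"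
    and truncation: "\<exists>N. \<forall>n\<ge>N. nprod a n b = 0"
    and vacuum: "nprod vac n a = (if n = -1 then a else 0)"
    and creation: "nprod a (-1) vac = a" "n \<ge> 0 \<Longrightarrow> nprod a n vac = 0"
    and jacobi:
      "Sum_any (\<lambda>i::nat. vscale (of_int m gchoose i)
                    (nprod (nprod a (n + int i) b) (m + k - int i) c)) =
       Sum_any (\<lambda>i::nat. vscale ((-1) ^ i * (of_int n gchoose i))
                    (nprod a (m + n - int i) (nprod b (k + int i) c)
                     - vscale ((-1) powi n) (nprod b (n + k - int i) (nprod a (m + int i) c))))"

definition va_automorphism ::
  "(complex \<Rightarrow> 'v::ab_group_add \<Rightarrow> 'v) \<Rightarrow> 'v \<Rightarrow> ('v \<Rightarrow> int \<Rightarrow> 'v \<Rightarrow> 'v) \<Rightarrow> ('v \<Rightarrow> 'v) \<Rightarrow> bool" where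
  "va_automorphism vscale vac nprod g \<longleftrightarrow>
     Vector_Spaces.linear vscale vscale g \<and> bij g \<and> g vac = vac \<and>
     (\<forall>a n b. g (nprod a n b) = nprod (g a) n (g b))"

definition Aut_group ::
  "(complex \<Rightarrow> 'v::ab_group_add \<Rightarrow> 'v) \<Rightarrow> 'v \<Rightarrow> ('v \<Rightarrow> int \<Rightarrow> 'v \<Rightarrow> 'v) \<Rightarrow> 'v \<Rightarrow> ('v \<Rightarrow> 'v) monoid" where
  "Aut_group vscale vac nprod \<omega> =
     \<lparr>carrier = {g. va_automorphism vscale vac nprod g \<and> g \<omega> = \<omega>}, mult = (\<circ>), one = id\<rparr>"


section \<open>The Heisenberg vertex algebra\<close>

text \<open>
  The vertex algebra structure on the level one vacuum module \<open>V\<close> is pinned down by its vacuum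
  and by \<open>Y(u(-1)vac, z) = \<Sum>n. u(n) z\<^bsup>-n-1\<^esup>\<close>, since the vectors \<open>u(-1)vac\<close> generate \<open>V\<close>.
\<close>

definition heisenberg_vertex_algebra ::
  "(complex \<Rightarrow> 'h::ab_group_add \<Rightarrow> 'h) \<Rightarrow> ('h \<Rightarrow> 'h \<Rightarrow> complex) \<Rightarrow>
   (complex \<Rightarrow> 'v::ab_group_add \<Rightarrow> 'v) \<Rightarrow> ('h heis \<Rightarrow> 'v \<Rightarrow> 'v) \<Rightarrow> 'v \<Rightarrow>
   ('v \<Rightarrow> int \<Rightarrow> 'v \<Rightarrow> 'v) \<Rightarrow> bool" where
  "heisenberg_vertex_algebra scale form vscale act vac nprod \<longleftrightarrow>
     induced_module (heis_scale scale) (heis_bracket form) heis_nonneg snd vscale act vac \<and>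
     vertex_algebra vscale vac nprod \<and>
     (\<forall>u n v. nprod (act (loop u (-1)) vac) n v = act (loop u n) v)"

definition omega ::
  "(complex \<Rightarrow> 'v::ab_group_add \<Rightarrow> 'v) \<Rightarrow> ('h::ab_group_add heis \<Rightarrow> 'v \<Rightarrow> 'v) \<Rightarrow> 'v \<Rightarrow>
   'h set \<Rightarrow> 'h \<Rightarrow> 'v" where
  "omega vscale act vac E h =
     vscale (1/2) (\<Sum>e\<in>E. act (loop e (-1)) (act (loop e (-1)) vac)) + act (loop h (-2)) vac"

text \<open>
  The restriction of \<open>g\<close> to the weight-one subspace, identified with \<open>'h\<close> through \<open>u \<mapsto> u(-1)vac\<close>;
  meaningful for automorphisms fixing the conformal vector, as these preserve that subspace.
\<close>

definition restrict_weight_one ::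
  "('h::ab_group_add heis \<Rightarrow> 'v \<Rightarrow> 'v) \<Rightarrow> 'v \<Rightarrow> ('v \<Rightarrow> 'v) \<Rightarrow> 'h \<Rightarrow> 'h" where
  "restrict_weight_one act vac g u =
     (THE u'. g (act (loop u (-1)) vac) = act (loop u' (-1)) vac)"

definition Reg_action ::
  "('h::ab_group_add heis \<Rightarrow> 'v \<Rightarrow> 'v) \<Rightarrow> 'v \<Rightarrow> ('v \<Rightarrow> 'v) \<Rightarrow> 'h set \<times> 'h \<Rightarrow> 'h set \<times> 'h" where
  "Reg_action act vac g =
     (\<lambda>(W, w). (restrict_weight_one act vac g ` W, restrict_weight_one act vac g w))"

end

theory Submission
  imports Defs
begin

text \<open>
  The argument has two independent halves.

  \<^item> \<^emph>\<open>Linear algebra.\<close> Over the complex numbers every regular subspace has an orthonormal basis,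
    and any vector of it can be put in a standard position relative to such a basis which depends
    only on whether the vector vanishes and on its norm: \<open>w = \<surd>\<langle>w,w\<rangle> b\<^sub>0\<close> for a non-isotropic vector
    and \<open>w = b\<^sub>0 + \<i> b\<^sub>1\<close> for a non-zero isotropic one (\<open>standard_frame\<close>). A pair \<open>(W, w)\<close> in
    \<open>Reg\<close> splits \<open>h\<close> orthogonally as \<open>w + (h - w)\<close>. As \<open>h\<close> is isotropic, \<open>h - w\<close> has norm
    \<open>- \<langle>w,w\<rangle>\<close>. Putting \<open>w\<close> in standard position inside \<open>W\<close> and \<open>h - w\<close> in standard position inside
    the complement of \<open>W\<close> gives an orthonormal basis of the whole space adapted to \<open>(W, w)\<close>
    (\<open>adapted_frame\<close>), and matching two such bases is an isometry fixing \<open>h\<close>. Hence the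
    quadruple (\<open>dim W\<close>, \<open>w = 0\<close>, \<open>w = h\<close>, \<open>\<langle>w,w\<rangle>\<close>) is a complete invariant of the orbits
    (\<open>Reg_transitive\<close>). The bounds on \<open>dim W\<close> hold because a regular space containing a non-zero
    isotropic vector has dimension at least two; all remaining values occur, since \<open>h\<close> can be given
    any non-zero coordinate vector with vanishing sum of squares (\<open>admissible_invariant_attained\<close>).

  \<^item> \<^emph>\<open>Vertex algebra.\<close> The automorphisms fixing the conformal vector restrict on the weight-one
    space to exactly the isometries fixing \<open>h\<close> (\<open>restriction_image\<close>). Such an automorphism commutes
    with the first mode of the conformal vector, whose eigenspace for the eigenvalue 1 is
    \<open>{u(-1)vac}\<close> (\<open>weight_one_space\<close>); it preserves the form because \<open>u(1)v(-1)vac = \<langle>u,v\<rangle>vac\<close>, and it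
    fixes \<open>h\<close> because \<open>u(2)\<omega> = 2\<langle>u,h\<rangle>vac\<close>. Both deductions need \<open>vac \<noteq> 0\<close>, i.e. that the empty
    word is not a consequence of the defining relations; this is witnessed by the vacuum
    expectation value, given by Wick's formula (\<open>word_Nil_not_relation\<close>). Conversely an isometry acts on
    the Heisenberg algebra, hence on the induced module by its universal property, and the
    resulting map is a homomorphism of vertex algebras since the iterate formula expresses the
    modes of \<open>u(n)b\<close> through those of \<open>u(-1)vac\<close> and of \<open>b\<close> (\<open>isometry_lift\<close>).
\<close>

section \<open>Orthonormal frames\<close>

context quadratic_space
begin

lemma form_add_right: "form u (v + w) = form u v + form u w"
  and form_scale_right: "form u (scale c v) = c * form u v"
  using form_linear[of u] by (auto simp: Vector_Spaces.linear_iff)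

lemma form_add_left: "form (v + w) u = form v u + form w u"
  and form_scale_left: "form (scale c v) u = c * form v u"
  by (metis form_add_right form_sym, metis form_scale_right form_sym)

lemma form_zero_left [simp]: "form 0 u = 0" and form_zero_right [simp]: "form u 0 = 0"
  by (metis form_add_left add_cancel_left_left, metis form_add_right add_cancel_left_left)

lemma form_diff_left: "form (v - w) u = form v u - form w u"
  by (metis add_diff_cancel_right' diff_add_cancel form_add_left)

lemma form_diff_right: "form u (v - w) = form u v - form u w"
  by (metis form_diff_left form_sym)

lemma form_sum_left: "form (\<Sum>i\<in>I. f i) u = (\<Sum>i\<in>I. form (f i) u)"
  by (induction I rule: infinite_finite_induct) (auto simp: form_add_left)

lemma form_sum_right: "form u (\<Sum>i\<in>I. f i) = (\<Sum>i\<in>I. form u (f i))"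
  by (induction I rule: infinite_finite_induct) (auto simp: form_add_right)

lemmas form_simps = form_add_left form_add_right form_scale_left form_scale_right
  form_diff_left form_diff_right

text \<open>
  Orthonormal systems are indexed by natural numbers rather than given as sets: bases of two spaces
  are to be matched entry by entry, and bases of a subspace and of its complement to be concatenated.
\<close>

definition orthonormal_on :: "nat set \<Rightarrow> (nat \<Rightarrow> 'h) \<Rightarrow> bool" where
  "orthonormal_on I b \<longleftrightarrow> (\<forall>i\<in>I. \<forall>j\<in>I. form (b i) (b j) = (if i = j then 1 else 0))"

definition comb :: "nat set \<Rightarrow> (nat \<Rightarrow> complex) \<Rightarrow> (nat \<Rightarrow> 'h) \<Rightarrow> 'h" where
  "comb I a b = (\<Sum>i\<in>I. scale (a i) (b i))"

lemma comb_in_span: "comb I a b \<in> span (b ` I)"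
  unfolding comb_def by (intro span_sum span_scale span_base) auto

lemma form_comb:
  assumes "orthonormal_on J b" "finite I" "I \<subseteq> J" "j \<in> J"
  shows "form (comb I a b) (b j) = (if j \<in> I then a j else 0)"
proof -
  have "form (comb I a b) (b j) = (\<Sum>i\<in>I. a i * form (b i) (b j))"
    by (simp add: comb_def form_sum_left form_scale_left)
  also have "\<dots> = (\<Sum>i\<in>I. if i = j then a j else 0)"
    using assms by (intro sum.cong) (auto simp: orthonormal_on_def)
  finally show ?thesis using assms by simp
qed

lemma form_comb_comb:
  assumes "orthonormal_on I b" "finite I"
  shows "form (comb I a b) (comb I a' b) = (\<Sum>i\<in>I. a i * a' i)"
proof -
  have "form (comb I a b) (comb I a' b) = (\<Sum>i\<in>I. a' i * form (comb I a b) (b i))"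
    by (simp add: comb_def[of I a'] form_sum_right form_scale_right)
  also have "\<dots> = (\<Sum>i\<in>I. a i * a' i)"
    using assms by (intro sum.cong) (auto simp: form_comb)
  finally show ?thesis .
qed

lemma comb_expansion:
  assumes "orthonormal_on I b" "finite I" "v \<in> span (b ` I)"
  shows "comb I (\<lambda>i. form v (b i)) b = v"
  using assms(3)
proof (induction rule: span_induct)
  case base
  show ?case
    unfolding subspace_def
    by (auto simp: comb_def form_simps scale_left_distrib sum.distrib
        simp flip: scale_scale scale_sum_right)
next
  case (step x)
  then obtain j where j: "j \<in> I" "x = b j" by auto
  have "comb I (\<lambda>i. form x (b i)) b = (\<Sum>i\<in>I. if i = j then b j else 0)"
    unfolding comb_def j using assms(1) j(1)
    by (intro sum.cong) (auto simp: orthonormal_on_def)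
  then show ?case using assms(2) j by simp
qed

lemma orthonormal_on_inj: "orthonormal_on I b \<Longrightarrow> inj_on b I"
  unfolding orthonormal_on_def inj_on_def by (metis zero_neq_one)

lemma orthonormal_on_independent:
  assumes "orthonormal_on I b" "finite I"
  shows "independent (b ` I)"
proof
  assume "dependent (b ` I)"
  then obtain j where j: "j \<in> I" "b j \<in> span (b ` I - {b j})"
    by (auto simp: dependent_def)
  have "b ` I - {b j} = b ` (I - {j})"
    using orthonormal_on_inj[OF assms(1)] j(1) by (auto simp: inj_on_def)
  moreover have o: "orthonormal_on (I - {j}) b" using assms(1) by (auto simp: orthonormal_on_def)
  ultimately have "b j = comb (I - {j}) (\<lambda>i. form (b j) (b i)) b"
    using comb_expansion[OF o] j(2) assms(2) by simp
  then have "form (b j) (b j) = 0"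
    using form_comb[OF assms(1), of "I - {j}" j] j(1) assms(2)
    by (metis Diff_iff Diff_subset finite_Diff singletonI)
  then show False using assms(1) j(1) by (auto simp: orthonormal_on_def)
qed

lemma dim_frame:
  assumes "orthonormal_on {..<k} b" "span (b ` {..<k}) = W"
  shows "dim W = k"
proof -
  have "dim W = card (b ` {..<k})"
    using dim_span_eq_card_independent[OF orthonormal_on_independent[OF assms(1)]] assms(2) by simp
  then show ?thesis by (simp add: card_image orthonormal_on_inj[OF assms(1)])
qed

text \<open>
  Otherwise every vector of \<open>W\<close> orthogonal to the system would be isotropic; by polarization the form
  would vanish on all these vectors, so they would lie in the radical of \<open>W\<close> and be zero.
\<close>

lemma orthonormal_on_extend_one:
  assumes reg: "regular_subspace scale form W"
    and on: "orthonormal_on {..<j} b" and sub: "b ` {..<j} \<subseteq> W" and ne: "span (b ` {..<j}) \<noteq> W"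
  shows "\<exists>v\<in>W. orthonormal_on {..<Suc j} (b(j := v))"
proof -
  have W: "subspace W" using reg by (simp add: regular_subspace_def)
  define p where "p v = comb {..<j} (\<lambda>i. form v (b i)) b" for v
  have pW: "p v \<in> W" for v
    using comb_in_span[of "{..<j}" _ b] span_minimal[OF sub W] by (auto simp: p_def)
  \<comment> \<open>The part of \<open>W\<close> orthogonal to the system; any non-isotropic vector of it can be normalized and added.\<close>
  define K where "K = {w\<in>W. \<forall>i<j. form w (b i) = 0}"
  have residual: "v - p v \<in> K" if "v \<in> W" for v
    using that pW W form_comb[OF on, of "{..<j}"]
    by (auto simp: K_def subspace_diff form_diff_left p_def)
  have "\<exists>u\<in>K. form u u \<noteq> 0"
  proof (rule ccontr)
    assume "\<not> ?thesis"
    then have iso: "\<And>u. u \<in> K \<Longrightarrow> form u u = 0" by blast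
    have K0: "form x y = 0" if "x \<in> K" "y \<in> K" for x y
    proof -
      have "x + y \<in> K" using that W by (auto simp: K_def subspace_add form_add_left)
      from iso[OF this] iso[OF that(1)] iso[OF that(2)] show ?thesis
        by (simp add: form_simps form_sym[of y x])
    qed
    have "span (b ` {..<j}) \<subseteq> W" using span_minimal[OF sub W] .
    with ne obtain w where w: "w \<in> W" "w \<notin> span (b ` {..<j})" by blast
    have "form (w - p w) v = 0" if "v \<in> W" for v
    proof -
      have "form (w - p w) (v - p v) = 0" using K0 residual w(1) that by blast
      moreover have "form (w - p w) (p v) = 0"
        using residual[OF w(1)] by (auto simp: p_def[of v] comb_def form_sum_right form_scale_right K_def)
      ultimately show ?thesis by (simp add: form_diff_right)
    qed
    moreover have "w - p w \<in> W" using w pW W by (simp add: subspace_diff)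
    ultimately have "w - p w = 0" using reg unfolding regular_subspace_def by blast
    then have "w = p w" by simp
    with w(2) comb_in_span[of "{..<j}" _ b] show False by (metis p_def)
  qed
  then obtain u where u: "u \<in> K" "form u u \<noteq> 0" by blast
  define v where "v = scale (1 / csqrt (form u u)) u"
  have "csqrt (form u u) * csqrt (form u u) = form u u" by (metis power2_csqrt power2_eq_square)
  then have "form v v = 1" using u(2) by (simp add: v_def form_simps)
  moreover have "form v (b i) = 0" "form (b i) v = 0" if "i < j" for i
    using u that by (auto simp: v_def form_simps K_def form_sym)
  moreover have "v \<in> W" using u W by (auto simp: v_def K_def subspace_scale)
  ultimately show ?thesis
    using on by (intro bexI[of _ v]) (auto simp: orthonormal_on_def less_Suc_eq)
qed

lemma orthonormal_on_extend:
  assumes reg: "regular_subspace scale form W"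
    and on: "orthonormal_on {..<j} b" and sub: "b ` {..<j} \<subseteq> W"
  shows "\<exists>b'. (\<forall>i<j. b' i = b i) \<and> j \<le> dim W \<and> orthonormal_on {..<dim W} b'
    \<and> span (b' ` {..<dim W}) = W"
proof -
  obtain B where B: "finite B" "span B = UNIV" using finite_dim by blast
  have bound: "j \<le> card B" if "orthonormal_on {..<j} b" for j b
    using independent_span_bound[OF B(1) orthonormal_on_independent[OF that]] B(2)
    by (simp add: card_image orthonormal_on_inj[OF that])
  show ?thesis using on sub
  proof (induction "card B - j" arbitrary: j b rule: less_induct)
    case less
    show ?case
    proof (cases "span (b ` {..<j}) = W")
      case True
      with dim_frame[OF less.prems(1) True] less.prems show ?thesis by auto
    next
      case False
      then obtain v where v: "v \<in> W" "orthonormal_on {..<Suc j} (b(j := v))"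
        using orthonormal_on_extend_one[OF reg less.prems] by blast
      have sub': "(b(j := v)) ` {..<Suc j} \<subseteq> W" using v(1) less.prems(2) by (auto simp: less_Suc_eq)
      have "card B - Suc j < card B - j" using bound[OF v(2)] by linarith
      from less.hyps[OF this v(2) sub'] show ?thesis
        by (metis Suc_leD fun_upd_other less_SucI order_less_irrefl)
    qed
  qed
qed

text \<open>
  Coordinates of a vector \<open>w\<close> in standard position, where \<open>z\<close> is the truth value of \<open>w = 0\<close> and \<open>y\<close>
  is the norm \<open>\<langle>w,w\<rangle>\<close>. In the last case \<open>w = b\<^sub>0 + \<i> b\<^sub>1\<close> is isotropic.
\<close>

definition standard_coord :: "bool \<Rightarrow> complex \<Rightarrow> nat \<Rightarrow> complex" where
  "standard_coord z y i =
     (if z then 0 else if y \<noteq> 0 then (if i = 0 then csqrt y else 0)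
      else if i = 0 then 1 else if i = 1 then \<i> else 0)"

text \<open>
  A non-zero isotropic vector \<open>w\<close> of \<open>W\<close> is half of a hyperbolic pair \<open>(w, v)\<close>; the vectors
  \<open>w/2 + v\<close> and \<open>\<i>(v - w/2)\<close> are then orthonormal.
\<close>

lemma hyperbolic_frame:
  assumes W: "regular_subspace scale form W" and w: "w \<in> W" "w \<noteq> 0" "form w w = 0"
  shows "\<exists>b. orthonormal_on {..<2} b \<and> b ` {..<2} \<subseteq> W \<and> w = b 0 + scale \<i> (b 1)"
proof -
  have sub: "subspace W" using W by (simp add: regular_subspace_def)
  obtain v0 where v0: "v0 \<in> W" "form w v0 \<noteq> 0"
    using W w unfolding regular_subspace_def by blast
  define v1 where "v1 = scale (1 / form w v0) v0"
  \<comment> \<open>This correction makes \<open>v\<close> isotropic without changing its pairing with \<open>w\<close>.\<close>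
  define v where "v = v1 - scale (form v1 v1 / 2) w"
  have v1: "v1 \<in> W" "form w v1 = 1" "form v1 w = 1"
    using v0 sub by (auto simp: v1_def form_simps subspace_scale form_sym)
  have v: "v \<in> W" "form w v = 1" "form v w = 1" "form v v = 0"
    using v1 w sub by (auto simp: v_def form_simps subspace_scale subspace_diff)
  define e where "e = scale (1/2) w + v"
  define f where "f = scale \<i> (v - scale (1/2) w)"
  have ef: "form e e = 1" "form f f = 1" "form e f = 0" "form f e = 0"
    using v w by (auto simp: e_def f_def form_simps)
  have "e \<in> W" "f \<in> W" using v w sub
    by (auto simp: e_def f_def subspace_scale subspace_add subspace_diff intro!: subspace_neg)
  moreover have "e + scale \<i> f = scale (1/2 + 1/2) w"
    by (simp only: scale_left_distrib) (simp add: e_def f_def)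
  ultimately show ?thesis using ef
    by (intro exI[of _ "\<lambda>i. if i = 0 then e else f"]) (auto simp: orthonormal_on_def less_2_cases_iff)
qed

lemma standard_frame:
  assumes W: "regular_subspace scale form W" and w: "w \<in> W"
  shows "\<exists>b. orthonormal_on {..<dim W} b \<and> span (b ` {..<dim W}) = W
    \<and> w = comb {..<dim W} (standard_coord (w = 0) (form w w)) b
    \<and> (w \<noteq> 0 \<longrightarrow> 1 \<le> dim W) \<and> (w \<noteq> 0 \<and> form w w = 0 \<longrightarrow> 2 \<le> dim W)"
proof -
  have sub: "subspace W" using W by (simp add: regular_subspace_def)
  consider "w = 0" | "form w w \<noteq> 0" | "w \<noteq> 0" "form w w = 0" by blast
  then show ?thesis
  proof cases
    case 1
    with orthonormal_on_extend[OF W, of 0] show ?thesis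
      by (auto simp: comb_def standard_coord_def orthonormal_on_def)
  next
    case 2
    define y where "y = form w w"
    define e where "e = scale (1 / csqrt y) w"
    have yy: "csqrt y * csqrt y = y" by (metis power2_csqrt power2_eq_square)
    have e: "form e e = 1" "e \<in> W" "w = scale (csqrt y) e"
      using 2 yy w sub by (auto simp: e_def form_simps subspace_scale simp flip: y_def)
    have "orthonormal_on {..<1} (\<lambda>_. e)" using e by (auto simp: orthonormal_on_def)
    from orthonormal_on_extend[OF W this] e obtain b where
      b: "b 0 = e" "1 \<le> dim W" "orthonormal_on {..<dim W} b" "span (b ` {..<dim W}) = W" by auto
    have "comb {..<dim W} (standard_coord (w = 0) (form w w)) b
        = (\<Sum>i<dim W. if i = 0 then scale (csqrt y) e else 0)"
      unfolding comb_def using 2 b(1) by (intro sum.cong) (auto simp: standard_coord_def y_def)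
    also have "\<dots> = w" using b(2) e by (simp add: sum.delta)
    finally show ?thesis using b 2 by metis
  next
    case 3
    from hyperbolic_frame[OF W w 3] obtain b0 where
      b0: "orthonormal_on {..<2} b0" "b0 ` {..<2} \<subseteq> W" "w = b0 0 + scale \<i> (b0 1)" by blast
    from orthonormal_on_extend[OF W b0(1,2)] obtain b where
      "\<forall>i<2. b i = b0 i" and b: "2 \<le> dim W" "orthonormal_on {..<dim W} b"
      "span (b ` {..<dim W}) = W" by blast
    then have b01: "b 0 = b0 0" "b 1 = b0 1" by auto
    have "comb {..<dim W} (standard_coord (w = 0) (form w w)) b
        = (\<Sum>i\<in>{0,1}. scale (standard_coord (w = 0) (form w w) i) (b i))"
      unfolding comb_def using 3 b(1)
      by (intro sum.mono_neutral_right) (auto simp: standard_coord_def)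
    also have "\<dots> = w" using 3 b01 b0(3) by (simp add: standard_coord_def)
    finally show ?thesis using b by (metis one_le_numeral order_trans)
  qed
qed

section \<open>Bases adapted to a regular subspace\<close>

definition orth_compl :: "'h set \<Rightarrow> 'h set" where
  "orth_compl W = {v. \<forall>u\<in>W. form v u = 0}"

lemma orth_compl_sym: "v \<in> orth_compl W \<Longrightarrow> u \<in> W \<Longrightarrow> form u v = 0 \<and> form v u = 0"
  by (auto simp: orth_compl_def form_sym)

lemma orth_compl_span: "v \<in> orth_compl (span S) \<longleftrightarrow> (\<forall>s\<in>S. form v s = 0)"
proof
  assume v: "\<forall>s\<in>S. form v s = 0"
  have "form v u = 0" if "u \<in> span S" for u
    using that by (induction rule: span_induct) (auto simp: v subspace_def form_simps)
  then show "v \<in> orth_compl (span S)" by (simp add: orth_compl_def)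
qed (auto simp: orth_compl_def span_base)

lemma subspace_orth_compl: "subspace (orth_compl W)"
  by (auto simp: subspace_def orth_compl_def form_simps)

lemma regular_span_orthonormal:
  assumes "orthonormal_on I b" "finite I"
  shows "regular_subspace scale form (span (b ` I))"
  unfolding regular_subspace_def
proof (intro conjI ballI impI)
  fix u assume u: "u \<in> span (b ` I)" "\<forall>v\<in>span (b ` I). form u v = 0"
  then have "comb I (\<lambda>i. form u (b i)) b = 0"
    by (auto simp: comb_def span_base intro!: sum.neutral)
  then show "u = 0" using comb_expansion[OF assms u(1)] by simp
qed auto

lemma regular_UNIV: "regular_subspace scale form UNIV"
  using form_nondegenerate by (auto simp: regular_subspace_def)

lemma regular_decomp:
  assumes "regular_subspace scale form W"
  obtains p where "p \<in> W" "v - p \<in> orth_compl W"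
proof -
  obtain b where b: "orthonormal_on {..<dim W} b" "span (b ` {..<dim W}) = W"
    using orthonormal_on_extend[OF assms, of 0] by (auto simp: orthonormal_on_def)
  let ?p = "comb {..<dim W} (\<lambda>i. form v (b i)) b"
  have "v - ?p \<in> orth_compl (span (b ` {..<dim W}))"
    unfolding orth_compl_span by (auto simp: form_diff_left form_comb[OF b(1)])
  moreover have "?p \<in> W" using comb_in_span b(2) by blast
  ultimately show ?thesis using that b(2) by simp
qed

lemma regular_orth_compl:
  assumes "regular_subspace scale form W"
  shows "regular_subspace scale form (orth_compl W)"
  unfolding regular_subspace_def
proof (intro conjI ballI impI subspace_orth_compl)
  fix u assume u: "u \<in> orth_compl W" "\<forall>v\<in>orth_compl W. form u v = 0"
  have "form u v = 0" for v
  proof -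
    obtain p where p: "p \<in> W" "v - p \<in> orth_compl W" using regular_decomp[OF assms] by blast
    then have "form u p = 0" "form u (v - p) = 0" using u by (auto simp: orth_compl_def)
    then show ?thesis by (simp add: form_diff_right)
  qed
  then show "u = 0" by (rule form_nondegenerate)
qed

text \<open>
  This turns the definite description of the projection into the orthogonal splitting
  \<open>h = w + (h - w)\<close>, the form in which membership in \<open>Reg\<close> is used from here on.
\<close>

lemma Reg_iff:
  "(W, w) \<in> Reg scale form h \<longleftrightarrow>
     regular_subspace scale form W \<and> w \<in> W \<and> h - w \<in> orth_compl W"
proof (cases "regular_subspace scale form W")
  case True
  then obtain p where p: "p \<in> W" "h - p \<in> orth_compl W" using regular_decomp by blast
  have uniq: "q = p" if q: "q \<in> W" "h - q \<in> orth_compl W" for q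
  proof -
    have "subspace W" using True by (simp add: regular_subspace_def)
    then have "q - p \<in> W" using p q by (simp add: subspace_diff)
    moreover have "form (q - p) u = 0" if "u \<in> W" for u
      using p q that by (simp add: orth_compl_def form_simps)
    ultimately have "q - p = 0" using True unfolding regular_subspace_def by blast
    then show ?thesis by simp
  qed
  have "orth_proj form W h = p"
    unfolding orth_proj_def
  proof (rule the_equality)
    show "q = p" if "q \<in> W \<and> (\<forall>u\<in>W. form (h - q) u = 0)" for q
      using that by (intro uniq) (auto simp: orth_compl_def)
  qed (use p in \<open>auto simp: orth_compl_def\<close>)
  then have "(W, w) \<in> Reg scale form h \<longleftrightarrow> w = p" using True by (simp add: Reg_def)
  also have "\<dots> \<longleftrightarrow> w \<in> W \<and> h - w \<in> orth_compl W" using p uniq[of w] by blast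
  finally show ?thesis using True by simp
qed (auto simp: Reg_def)

text \<open>
  Standard frames for \<open>w\<close> in \<open>W\<close> and for \<open>h - w\<close> in the complement, one after the other. The basis
  knows \<open>W\<close>, \<open>w\<close> and \<open>h\<close>, and the coordinates of \<open>w\<close> and \<open>h\<close> depend on numerical data only. The
  last four conjuncts record the room that the standard positions require.
\<close>

lemma adapted_frame:
  assumes "(W, w) \<in> Reg scale form h"
  defines "d \<equiv> dim UNIV"
  shows "\<exists>b. orthonormal_on {..<d} b \<and> span (b ` {..<d}) = UNIV \<and> span (b ` {..<dim W}) = W
    \<and> dim W \<le> d
    \<and> w = comb {..<dim W} (standard_coord (w = 0) (form w w)) b
    \<and> h - w = comb {dim W..<d}
        (\<lambda>i. standard_coord (h - w = 0) (form (h - w) (h - w)) (i - dim W)) b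
    \<and> (w \<noteq> 0 \<longrightarrow> 1 \<le> dim W) \<and> (w \<noteq> 0 \<and> form w w = 0 \<longrightarrow> 2 \<le> dim W)
    \<and> (w \<noteq> h \<longrightarrow> dim W + 1 \<le> d) \<and> (w \<noteq> h \<and> form (h - w) (h - w) = 0 \<longrightarrow> dim W + 2 \<le> d)"
proof -
  have W: "regular_subspace scale form W" and w: "w \<in> W" "h - w \<in> orth_compl W"
    using assms(1) by (auto simp: Reg_iff)
  define k where "k = dim W"
  define l where "l = dim (orth_compl W)"
  obtain b1 where b1: "orthonormal_on {..<k} b1" "span (b1 ` {..<k}) = W"
    "w = comb {..<k} (standard_coord (w = 0) (form w w)) b1"
    "w \<noteq> 0 \<longrightarrow> 1 \<le> k" "w \<noteq> 0 \<and> form w w = 0 \<longrightarrow> 2 \<le> k"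
    using standard_frame[OF W w(1), folded k_def] by (elim exE conjE) (rule that)
  obtain b2 where b2: "orthonormal_on {..<l} b2" "span (b2 ` {..<l}) = orth_compl W"
    "h - w = comb {..<l} (standard_coord (h - w = 0) (form (h - w) (h - w))) b2"
    "h - w \<noteq> 0 \<longrightarrow> 1 \<le> l" "h - w \<noteq> 0 \<and> form (h - w) (h - w) = 0 \<longrightarrow> 2 \<le> l"
    using standard_frame[OF regular_orth_compl[OF W] w(2), folded l_def] by (elim exE conjE) (rule that)
  define b where "b i = (if i < k then b1 i else b2 (i - k))" for i
  have in1: "b1 i \<in> W" if "i < k" for i
    using span_base[of "b1 i" "b1 ` {..<k}"] that by (simp add: b1(2))
  have in2: "b2 i \<in> orth_compl W" if "i < l" for i
    using span_base[of "b2 i" "b2 ` {..<l}"] that by (simp add: b2(2))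
  have on: "orthonormal_on {..<k + l} b"
    unfolding orthonormal_on_def
  proof (intro ballI)
    fix i j assume "i \<in> {..<k + l}" "j \<in> {..<k + l}"
    then show "form (b i) (b j) = (if i = j then 1 else 0)"
      using b1(1) b2(1) orth_compl_sym[OF in2[of "j - k"] in1[of i]]
        orth_compl_sym[OF in2[of "i - k"] in1[of j]]
      by (auto simp: b_def orthonormal_on_def)
  qed
  have im1: "b ` {..<k} = b1 ` {..<k}" by (auto simp: b_def)
  have im2: "b2 ` {..<l} = b ` {k..<k + l}"
  proof -
    have "b2 i \<in> b ` {k..<k + l}" if "i < l" for i
      using that by (intro image_eqI[of _ _ "i + k"]) (auto simp: b_def)
    then show ?thesis by (auto simp: b_def)
  qed
  have full: "span (b ` {..<k + l}) = UNIV"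
  proof -
    have "v \<in> span (b ` {..<k + l})" for v
    proof -
      obtain p where p: "p \<in> W" "v - p \<in> orth_compl W" using regular_decomp[OF W] by blast
      have "p \<in> span (b ` {..<k + l})"
        using p(1) span_mono[of "b ` {..<k}" "b ` {..<k + l}"] b1(2) im1
        by (metis image_mono lessThan_subset_iff le_add1 subsetD)
      moreover have "v - p \<in> span (b ` {..<k + l})"
        using p(2) span_mono[of "b ` {k..<k + l}" "b ` {..<k + l}"] b2(2) im2
        by (metis atLeast0LessThan image_mono ivl_subset order_refl subsetD zero_le)
      ultimately show ?thesis using span_add by fastforce
    qed
    then show ?thesis by blast
  qed
  have d: "d = k + l" using dim_frame[OF on full] by (simp add: d_def)
  have c1: "comb {..<k} a b = comb {..<k} a b1" for a by (simp add: comb_def b_def)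
  have c2: "comb {k..<k + l} (\<lambda>i. a (i - k)) b = comb {..<l} a b2" for a
    unfolding comb_def
    by (intro sum.reindex_bij_witness[of _ "\<lambda>i. i + k" "\<lambda>i. i - k"]) (auto simp: b_def)
  have bounds: "w \<noteq> h \<longrightarrow> k + 1 \<le> k + l"
    "w \<noteq> h \<and> form (h - w) (h - w) = 0 \<longrightarrow> k + 2 \<le> k + l"
    using b2(4,5) by auto
  show ?thesis
    unfolding d k_def[symmetric]
    using on full im1 b1(2)
    by (intro exI[of _ b] conjI b1(3)[folded c1] b1(4,5) b2(3)[folded c2] bounds) (simp_all only: le_add1)
qed

section \<open>Isometries\<close>

definition isometry :: "('h \<Rightarrow> 'h) \<Rightarrow> bool" where
  "isometry \<sigma> \<longleftrightarrow> Vector_Spaces.linear scale scale \<sigma> \<and> bij \<sigma> \<and> (\<forall>u v. form (\<sigma> u) (\<sigma> v) = form u v)"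

lemma isometry_simps:
  assumes "isometry \<sigma>"
  shows "\<sigma> (u + v) = \<sigma> u + \<sigma> v" "\<sigma> (scale c u) = scale c (\<sigma> u)" "form (\<sigma> u) (\<sigma> v) = form u v"
    "\<sigma> 0 = 0" "\<sigma> (u - v) = \<sigma> u - \<sigma> v" "\<sigma> u = \<sigma> v \<longleftrightarrow> u = v"
proof -
  show *: "\<sigma> (u + v) = \<sigma> u + \<sigma> v" "\<sigma> (scale c u) = scale c (\<sigma> u)" "form (\<sigma> u) (\<sigma> v) = form u v" for u v c
    using assms by (auto simp: isometry_def Vector_Spaces.linear_iff)
  show "\<sigma> 0 = 0" using *(1)[of 0 0] by simp
  show "\<sigma> (u - v) = \<sigma> u - \<sigma> v" using *(1)[of "u - v" v] by simp
  show "\<sigma> u = \<sigma> v \<longleftrightarrow> u = v" using assms by (auto simp: isometry_def bij_def inj_def)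
qed

lemma isometry_comb: "isometry \<sigma> \<Longrightarrow> \<sigma> (comb I a b) = comb I a (\<sigma> \<circ> b)"
  unfolding comb_def by (induction I rule: infinite_finite_induct) (auto simp: isometry_simps)

lemma isometry_span: "isometry \<sigma> \<Longrightarrow> \<sigma> ` span S = span (\<sigma> ` S)"
  using module_hom.span_image[of scale scale \<sigma> S]
  by (simp add: isometry_def module_hom_iff_linear)

lemma isometry_orthonormal: "isometry \<sigma> \<Longrightarrow> orthonormal_on I b \<Longrightarrow> orthonormal_on I (\<sigma> \<circ> b)"
  by (simp add: orthonormal_on_def isometry_simps)

text \<open>
  The isometry sending \<open>b\<^sub>i\<close> to \<open>c\<^sub>i\<close>, namely \<open>v \<mapsto> \<Sum>\<^sub>i \<langle>v, b\<^sub>i\<rangle> c\<^sub>i\<close>; exchanging \<open>b\<close> and \<open>c\<close> gives its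
  inverse.
\<close>

lemma frame_transport:
  assumes b: "orthonormal_on {..<d} b" "span (b ` {..<d}) = UNIV"
    and c: "orthonormal_on {..<d} c" "span (c ` {..<d}) = UNIV"
  obtains \<sigma> where "isometry \<sigma>" "\<And>I a. I \<subseteq> {..<d} \<Longrightarrow> \<sigma> (comb I a b) = comb I a c"
proof
  define t where "t b c v = comb {..<d} (\<lambda>i. form v (b i)) c" for b c v
  have inv: "t c b (t b c v) = v"
    if "orthonormal_on {..<d} b" "span (b ` {..<d}) = UNIV" "orthonormal_on {..<d} c" for b c v
  proof -
    have "t c b (t b c v) = comb {..<d} (\<lambda>i. form v (b i)) b"
      unfolding t_def comb_def[of _ _ b] using that(3)
      by (intro sum.cong) (auto simp: form_comb)
    then show ?thesis using comb_expansion[OF that(1), of v] that(2) by simp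
  qed
  have "bij (t b c)"
    by (rule o_bij[of "t c b"]) (use inv[OF b c(1)] inv[OF c b(1)] in auto)
  moreover have "form (t b c u) (t b c v) = form u v" for u v
  proof -
    have "form (t b c u) (t b c v) = form (t b b u) (t b b v)"
      by (simp add: t_def form_comb_comb b c)
    then show ?thesis using comb_expansion[OF b(1)] b(2) by (simp add: t_def)
  qed
  ultimately show "isometry (t b c)"
    unfolding isometry_def Vector_Spaces.linear_iff
    by (auto simp: t_def comb_def form_simps scale_left_distrib sum.distrib vector_space_axioms
        simp flip: scale_scale scale_sum_right)
  fix I :: "nat set" and a assume I: "I \<subseteq> {..<d}"
  have "t b c (comb I a b) = (\<Sum>i<d. if i \<in> I then scale (a i) (c i) else 0)"
    unfolding t_def comb_def[of _ _ c] using I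
    by (intro sum.cong) (auto simp: form_comb[OF b(1)] finite_subset)
  also have "\<dots> = comb I a c"
    using I by (simp add: comb_def sum.inter_restrict[symmetric] inf.absorb2)
  finally show "t b c (comb I a b) = comb I a c" .
qed

text \<open>
  The truth values of \<open>w = 0\<close> and \<open>w = h\<close> have to be part of the invariant: for \<open>\<langle>w,w\<rangle> = 0\<close> they
  separate the three kinds of orbits that have the same dimension.
\<close>

definition orbit_invariant :: "'h \<Rightarrow> 'h set \<times> 'h \<Rightarrow> nat \<times> bool \<times> bool \<times> complex" where
  "orbit_invariant h = (\<lambda>(W, w). (dim W, w = 0, w = h, form w w))"

lemma Reg_image:
  assumes "isometry \<sigma>" "\<sigma> h = h" "(W, w) \<in> Reg scale form h"
  shows "(\<sigma> ` W, \<sigma> w) \<in> Reg scale form h"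
    and "orbit_invariant h (\<sigma> ` W, \<sigma> w) = orbit_invariant h (W, w)"
proof -
  obtain b where b: "orthonormal_on {..<dim W} b" "span (b ` {..<dim W}) = W"
    using assms(3) orthonormal_on_extend[of W 0] by (auto simp: Reg_iff orthonormal_on_def)
  have o: "orthonormal_on {..<dim W} (\<sigma> \<circ> b)" using isometry_orthonormal[OF assms(1) b(1)] .
  have s: "span ((\<sigma> \<circ> b) ` {..<dim W}) = \<sigma> ` W"
    using isometry_span[OF assms(1)] b(2) by (metis image_comp)
  have "form (h - \<sigma> w) (\<sigma> u) = form (h - w) u" for u
    using isometry_simps(5)[OF assms(1), of h w] isometry_simps(3)[OF assms(1), of "h - w" u] assms(2)
    by simp
  then show "(\<sigma> ` W, \<sigma> w) \<in> Reg scale form h"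
    using assms(3) regular_span_orthonormal[OF o] s
    by (auto simp: Reg_iff orth_compl_def)
  have "\<sigma> w = 0 \<longleftrightarrow> w = 0" "\<sigma> w = h \<longleftrightarrow> w = h"
    using isometry_simps(4,6)[OF assms(1)] assms(2) by metis+
  then show "orbit_invariant h (\<sigma> ` W, \<sigma> w) = orbit_invariant h (W, w)"
    using dim_frame[OF o s] assms(1) by (simp add: orbit_invariant_def isometry_simps)
qed

lemma form_residual:
  assumes "form h h = 0" "(W, w) \<in> Reg scale form h"
  shows "form (h - w) (h - w) = - form w w"
proof -
  have "form (h - w) w = 0" using assms(2) by (auto simp: Reg_iff orth_compl_def)
  then show ?thesis using assms(1) form_sym[of h w] by (simp add: form_simps)
qed

text \<open>
  Adapted frames of the two pairs give \<open>w\<close>, \<open>w'\<close> the same coordinates, and likewise \<open>h - w\<close>,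
  \<open>h - w'\<close>, because \<open>\<langle>h - w, h - w\<rangle> = - \<langle>w,w\<rangle>\<close>. So the isometry matching the frames maps
  \<open>h = w + (h - w)\<close> to itself.
\<close>

lemma Reg_transitive:
  assumes hh: "form h h = 0"
    and x: "(W, w) \<in> Reg scale form h" and y: "(W', w') \<in> Reg scale form h"
    and eq: "orbit_invariant h (W, w) = orbit_invariant h (W', w')"
  shows "\<exists>\<sigma>. isometry \<sigma> \<and> \<sigma> h = h \<and> \<sigma> ` W = W' \<and> \<sigma> w = w'"
proof -
  let ?d = "dim UNIV"
  have k: "dim W' = dim W" and e: "(w' = 0) = (w = 0)" "(h - w' = 0) = (h - w = 0)"
    "form w' w' = form w w" using eq by (auto simp: orbit_invariant_def)
  have e': "form (h - w') (h - w') = form (h - w) (h - w)"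
    using form_residual[OF hh x] form_residual[OF hh y] e by simp
  obtain b where b: "orthonormal_on {..<?d} b" "span (b ` {..<?d}) = UNIV"
    "span (b ` {..<dim W}) = W" "dim W \<le> ?d"
    "w = comb {..<dim W} (standard_coord (w = 0) (form w w)) b"
    "h - w = comb {dim W..<?d}
        (\<lambda>i. standard_coord (h - w = 0) (form (h - w) (h - w)) (i - dim W)) b"
    using adapted_frame[OF x] by (elim exE conjE) (rule that)
  obtain c where c: "orthonormal_on {..<?d} c" "span (c ` {..<?d}) = UNIV"
    "span (c ` {..<dim W}) = W'"
    "w' = comb {..<dim W} (standard_coord (w = 0) (form w w)) c"
    "h - w' = comb {dim W..<?d}
        (\<lambda>i. standard_coord (h - w = 0) (form (h - w) (h - w)) (i - dim W)) c"
    using adapted_frame[OF y] unfolding k e e' by (elim exE conjE) (rule that)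
  obtain \<sigma> where \<sigma>: "isometry \<sigma>" "\<And>I a. I \<subseteq> {..<?d} \<Longrightarrow> \<sigma> (comb I a b) = comb I a c"
    using frame_transport[OF b(1,2) c(1,2)] by blast
  have w: "\<sigma> w = w'" using \<sigma>(2)[of "{..<dim W}"] b(4,5) c(4) by (metis lessThan_subset_iff)
  moreover have "\<sigma> (h - w) = h - w'"
    using \<sigma>(2)[of "{dim W..<?d}"] b(6) c(5) by (metis atLeastLessThan_iff lessThan_iff subsetI)
  ultimately have "\<sigma> h = h" using isometry_simps(5)[OF \<sigma>(1), of h w] by simp
  moreover have "\<sigma> (b i) = c i" if "i < dim W" for i
    using \<sigma>(2)[of "{i}" "\<lambda>_. 1"] that b(4) by (simp add: comb_def)
  then have "\<sigma> ` b ` {..<dim W} = c ` {..<dim W}"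
    unfolding image_image by (intro image_cong) auto
  then have "\<sigma> ` W = W'" using isometry_span[OF \<sigma>(1), of "b ` {..<dim W}"] b(3) c(3) by simp
  ultimately show ?thesis using \<sigma>(1) w by blast
qed

text \<open>
  The vector with coordinates \<open>c\<close> in some frame and \<open>h\<close> are both isotropic and non-zero, hence have
  frames in which they look alike. Matching these frames moves the first frame to one in which
  \<open>h\<close> has coordinates \<open>c\<close>.
\<close>

lemma frame_with_coords:
  assumes h: "h \<noteq> 0" "form h h = 0"
    and c: "(\<Sum>i<dim UNIV. c i * c i) = 0" "\<exists>i<dim UNIV. c i \<noteq> 0"
  obtains e where "orthonormal_on {..<dim UNIV} e" "span (e ` {..<dim UNIV}) = UNIV"
    "h = comb {..<dim UNIV} c e"
proof -
  let ?d = "dim UNIV"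
  obtain b where b: "orthonormal_on {..<?d} b" "span (b ` {..<?d}) = UNIV"
    "h = comb {..<?d} (standard_coord False 0) b"
    using standard_frame[OF regular_UNIV, of h] h by auto
  define g where "g = comb {..<?d} c b"
  have "form g g = 0" using c(1) by (simp add: g_def form_comb_comb b)
  moreover have "g \<noteq> 0"
    using c(2) form_comb[OF b(1), of "{..<?d}" _ c] unfolding g_def by fastforce
  ultimately obtain b' where b': "orthonormal_on {..<?d} b'" "span (b' ` {..<?d}) = UNIV"
    "g = comb {..<?d} (standard_coord False 0) b'"
    using standard_frame[OF regular_UNIV, of g] by auto
  obtain \<sigma> where \<sigma>: "isometry \<sigma>" "\<And>I a. I \<subseteq> {..<?d} \<Longrightarrow> \<sigma> (comb I a b') = comb I a b"
    using frame_transport[OF b'(1,2) b(1,2)] by blast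
  have "\<sigma> g = h" using \<sigma>(2)[of "{..<?d}" "standard_coord False 0"] b(3) b'(3) by simp
  then have "h = comb {..<?d} c (\<sigma> \<circ> b)" using isometry_comb[OF \<sigma>(1), of "{..<?d}" c b] by (simp add: g_def)
  moreover have "span ((\<sigma> \<circ> b) ` {..<?d}) = UNIV"
    using isometry_span[OF \<sigma>(1), of "b ` {..<?d}"] b(2) \<sigma>(1)
    by (simp add: image_comp isometry_def bij_is_surj)
  ultimately show ?thesis using that isometry_orthonormal[OF \<sigma>(1) b(1)] by blast
qed

text \<open>
  The subspace is spanned by the first \<open>k\<close> vectors of the frame provided by \<open>frame_with_coords\<close>.
  The projection of \<open>h\<close> is then read off from the first \<open>k\<close> coordinates.
\<close>

lemma Reg_with_coords:
  assumes h: "h \<noteq> 0" "form h h = 0" and k: "k \<le> dim UNIV"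
    and c: "(\<Sum>i<dim UNIV. c i * c i) = 0" "\<exists>i<dim UNIV. c i \<noteq> 0"
  shows "(k, \<forall>i<k. c i = 0, \<forall>i\<in>{k..<dim UNIV}. c i = 0, \<Sum>i<k. c i * c i)
    \<in> orbit_invariant h ` Reg scale form h"
proof -
  let ?d = "dim UNIV"
  obtain e where e: "orthonormal_on {..<?d} e" "span (e ` {..<?d}) = UNIV" "h = comb {..<?d} c e"
    using frame_with_coords[OF h c] by blast
  define W where "W = span (e ` {..<k})"
  define w where "w = comb {..<k} c e"
  have o: "orthonormal_on {..<k} e" using e(1) k by (auto simp: orthonormal_on_def)
  have hw: "h - w = comb {k..<?d} c e"
    using k by (simp add: e(3) w_def comb_def lessThan_atLeast0 sum_diff_nat_ivl)
  have zero: "comb I c e = 0 \<longleftrightarrow> (\<forall>i\<in>I. c i = 0)" if "I \<subseteq> {..<?d}" for I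
  proof
    assume "comb I c e = 0"
    then show "\<forall>i\<in>I. c i = 0"
      using form_comb[OF e(1) _ that, of _ c] that finite_subset[OF that]
      by (metis finite_lessThan form_zero_left subsetD)
  qed (simp add: comb_def)
  have "h - w \<in> orth_compl W"
    unfolding W_def orth_compl_span hw using k form_comb[OF e(1), of "{k..<?d}" _ c]
    by (auto simp: subset_iff)
  then have "(W, w) \<in> Reg scale form h"
    using regular_span_orthonormal[OF o] comb_in_span by (simp add: Reg_iff W_def w_def)
  moreover have "dim W = k" using dim_frame[OF o] by (simp add: W_def)
  moreover have "w = 0 \<longleftrightarrow> (\<forall>i<k. c i = 0)" using zero[of "{..<k}"] k by (auto simp: w_def)
  moreover have "w = h \<longleftrightarrow> (\<forall>i\<in>{k..<?d}. c i = 0)"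
    using zero[of "{k..<?d}"] hw by (metis atLeastLessThan_iff eq_iff_diff_eq_0 lessThan_iff subsetI)
  moreover have "form w w = (\<Sum>i<k. c i * c i)" by (simp add: w_def form_comb_comb o)
  ultimately have "orbit_invariant h (W, w)
      = (k, \<forall>i<k. c i = 0, \<forall>i\<in>{k..<?d}. c i = 0, \<Sum>i<k. c i * c i)"
    by (simp add: orbit_invariant_def)
  with \<open>(W, w) \<in> Reg scale form h\<close> show ?thesis by (metis image_eqI)
qed

section \<open>Orbits of the stabilizer of an isotropic vector\<close>

definition admissible_invariants :: "(nat \<times> bool \<times> bool \<times> complex) set" where
  "admissible_invariants =
     {(k, False, True, 0) | k. k \<in> {2..dim UNIV}} \<union>
     {(k, True, False, 0) | k. k \<in> {0..dim UNIV - 2}} \<union>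
     {(k, False, False, y) | k y. k \<in> {1..dim UNIV - 1} \<and> y \<noteq> 0} \<union>
     {(k, False, False, 0) | k. k \<in> {2..dim UNIV - 2}}"

lemma isotropic_imp_dim_ge_two:
  assumes "h \<noteq> 0" "form h h = 0"
  shows "2 \<le> dim UNIV"
  using standard_frame[OF regular_UNIV, of h] assms by blast

lemma orbit_invariant_admissible:
  assumes h: "h \<noteq> 0" "form h h = 0" and x: "(W, w) \<in> Reg scale form h"
  shows "orbit_invariant h (W, w) \<in> admissible_invariants"
proof -
  have k: "dim W \<le> dim UNIV" "w \<noteq> 0 \<longrightarrow> 1 \<le> dim W"
    "w \<noteq> 0 \<and> form w w = 0 \<longrightarrow> 2 \<le> dim W" "w \<noteq> h \<longrightarrow> dim W + 1 \<le> dim UNIV"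
    "w \<noteq> h \<and> form (h - w) (h - w) = 0 \<longrightarrow> dim W + 2 \<le> dim UNIV"
    using adapted_frame[OF x] by blast+
  show ?thesis
    using k h form_residual[OF h(2) x]
    by (cases "w = 0"; cases "w = h"; cases "form w w = 0")
      (auto simp: orbit_invariant_def admissible_invariants_def)
qed

text \<open>
  By \<open>Reg_with_coords\<close> it is enough to choose coordinates of \<open>h\<close>. In the first three cases a single
  pair \<open>a, \<i>a\<close> at positions \<open>p < q\<close> does: both in \<open>W\<close>, both outside, or one on either side. The last
  case takes one pair in \<open>W\<close> and another one outside.
\<close>

lemma admissible_invariant_attained:
  assumes h: "h \<noteq> 0" "form h h = 0" and t: "t \<in> admissible_invariants"
  shows "t \<in> orbit_invariant h ` Reg scale form h"
proof -
  let ?d = "dim UNIV"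
  have d: "2 \<le> ?d" using isotropic_imp_dim_ge_two[OF h] .
  have sq: "(\<Sum>i<n. (if i = p then a else if i = q then b else 0) *
        (if i = p then a else if i = q then b else 0))
      = (if p < n then a * a else 0) + (if q < n then b * b else 0)"
    if "p \<noteq> q" for n p q :: nat and a b :: complex
  proof -
    have "(\<Sum>i<n. (if i = p then a else if i = q then b else 0) *
          (if i = p then a else if i = q then b else 0))
        = (\<Sum>i<n. (if i = p then a * a else 0) + (if i = q then b * b else 0))"
      using that by (intro sum.cong) auto
    then show ?thesis by (simp add: sum.distrib)
  qed
  \<comment> \<open>Two coordinates \<open>a\<close> and \<open>\<i> a\<close> at positions \<open>p\<close> and \<open>q\<close>, whose squares cancel.\<close>
  define c :: "nat \<Rightarrow> nat \<Rightarrow> complex \<Rightarrow> nat \<Rightarrow> complex" where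
    "c p q a i = (if i = p then a else if i = q then \<i> * a else 0)" for p q a i
  have csq: "(\<Sum>i<n. c p q a i * c p q a i)
      = (if p < n then a * a else 0) - (if q < n then a * a else 0)"
    if "p \<noteq> q" for n p q a
  proof -
    have "\<i> * a * (\<i> * a) = (\<i> * \<i>) * (a * a)" by (simp only: mult_ac)
    then show ?thesis using sq[OF that, of a "\<i> * a" n] by (simp add: c_def)
  qed
  have pair: "(k, p \<ge> k \<and> q \<ge> k, p < k \<and> q < k, if p < k \<and> q \<ge> k then a * a else 0)
      \<in> orbit_invariant h ` Reg scale form h"
    if "p < q" "q < ?d" "a \<noteq> 0" "k \<le> ?d" for k p q a
  proof -
    have "(\<Sum>i<?d. c p q a i * c p q a i) = 0" using csq[of p q a ?d] that by simp
    moreover have "\<exists>i<?d. c p q a i \<noteq> 0" using that by (intro exI[of _ p]) (auto simp: c_def)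
    ultimately have "(k, \<forall>i<k. c p q a i = 0, \<forall>i\<in>{k..<?d}. c p q a i = 0,
        \<Sum>i<k. c p q a i * c p q a i) \<in> orbit_invariant h ` Reg scale form h"
      using Reg_with_coords[OF h that(4)] by blast
    moreover have "(\<forall>i<k. c p q a i = 0) \<longleftrightarrow> p \<ge> k \<and> q \<ge> k"
      using that by (auto simp: c_def not_less[symmetric])
    moreover have "(\<forall>i\<in>{k..<?d}. c p q a i = 0) \<longleftrightarrow> p < k \<and> q < k"
      using that by (auto simp: c_def not_le[symmetric])
    moreover have "(\<Sum>i<k. c p q a i * c p q a i) = (if p < k \<and> q \<ge> k then a * a else 0)"
      using csq[of p q a k] that by auto
    ultimately show ?thesis by simp
  qed
  consider (J1) k where "t = (k, False, True, 0)" "2 \<le> k" "k \<le> ?d"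
    | (J2) k where "t = (k, True, False, 0)" "k + 2 \<le> ?d"
    | (J3) k y where "t = (k, False, False, y)" "1 \<le> k" "k + 1 \<le> ?d" "y \<noteq> 0"
    | (J4) k where "t = (k, False, False, 0)" "2 \<le> k" "k + 2 \<le> ?d"
    using t d unfolding admissible_invariants_def by force
  then show ?thesis
  proof cases
    case J1
    then show ?thesis using pair[of 0 1 1 k] by auto
  next
    case J2
    then show ?thesis using pair[of k "k + 1" 1 k] by auto
  next
    case J3
    have "csqrt y * csqrt y = y" by (metis power2_csqrt power2_eq_square)
    then show ?thesis using pair[of 0 k "csqrt y" k] J3 by auto
  next
    case J4
    \<comment> \<open>One such pair in \<open>W\<close> makes \<open>w\<close> isotropic and non-zero, the other one keeps it apart from \<open>h\<close>.\<close>
    define e where "e i = c 0 1 1 i + c k (k + 1) 1 i" for i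
    have e2: "e i * e i = c 0 1 1 i * c 0 1 1 i + c k (k + 1) 1 i * c k (k + 1) 1 i" for i
      using J4 by (auto simp: e_def c_def)
    have s: "(\<Sum>i<?d. e i * e i) = 0" "(\<Sum>i<k. e i * e i) = 0"
      using J4 csq[of 0 1 1] csq[of k "k + 1" 1] by (auto simp: e2 sum.distrib)
    have e0: "e 0 \<noteq> 0" "e k \<noteq> 0" using J4 by (auto simp: e_def c_def)
    have "(k, \<forall>i<k. e i = 0, \<forall>i\<in>{k..<?d}. e i = 0, \<Sum>i<k. e i * e i)
        \<in> orbit_invariant h ` Reg scale form h"
      using Reg_with_coords[OF h _ s(1), of k] e0 J4 by (meson add_leD1 le_trans less_le_trans pos2)
    moreover have "\<not> (\<forall>i<k. e i = 0)" "\<not> (\<forall>i\<in>{k..<?d}. e i = 0)"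
      using e0 J4 by (auto intro!: exI[of _ 0] bexI[of _ k])
    ultimately show ?thesis using J4(1) s(2) by simp
  qed
qed

lemma J_as_fibres:
  assumes h: "h \<noteq> 0" "form h h = 0"
  shows "J1 scale form h k = {x \<in> Reg scale form h. orbit_invariant h x = (k, False, True, 0)}"
    and "J2 scale form h k = {x \<in> Reg scale form h. orbit_invariant h x = (k, True, False, 0)}"
    and "y \<noteq> 0 \<Longrightarrow>
      J3 scale form h k y = {x \<in> Reg scale form h. orbit_invariant h x = (k, False, False, y)}"
    and "J4 scale form h k = {x \<in> Reg scale form h. orbit_invariant h x = (k, False, False, 0)}"
  using h by (auto simp: J1_def J2_def J3_def J4_def orbit_invariant_def)

text \<open>
  Both claims are statements about the fibres of the invariant: the orbits are its non-empty fibres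
  on \<open>Reg\<close>, and the sets \<open>J\<^sub>i\<close> are its fibres over the admissible values.
\<close>

theorem isometry_orbits:
  assumes h: "h \<noteq> 0" "form h h = 0"
  shows "{{(\<sigma> ` fst x, \<sigma> (snd x)) | \<sigma>. isometry \<sigma> \<and> \<sigma> h = h} | x. x \<in> Reg scale form h} =
      {J1 scale form h k | k. k \<in> {2..dim UNIV}} \<union>
      {J2 scale form h k | k. k \<in> {0..dim UNIV - 2}} \<union>
      {J3 scale form h k y | k y. k \<in> {1..dim UNIV - 1} \<and> y \<noteq> 0} \<union>
      {J4 scale form h k | k. k \<in> {2..dim UNIV - 2}}" (is "?orbits = ?J")
    and "Reg scale form h =
      (\<Union>k\<in>{2..dim UNIV}. J1 scale form h k) \<union>
      (\<Union>k\<in>{0..dim UNIV - 2}. J2 scale form h k) \<union>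
      (\<Union>k\<in>{1..dim UNIV - 1}. \<Union>y\<in>{y. y \<noteq> 0}. J3 scale form h k y) \<union>
      (\<Union>k\<in>{2..dim UNIV - 2}. J4 scale form h k)" (is "_ = ?U")
proof -
  let ?R = "Reg scale form h" and ?inv = "orbit_invariant h"
  define fibre where "fibre t = {x \<in> ?R. ?inv x = t}" for t
  have inv: "?inv ` ?R = admissible_invariants"
    using orbit_invariant_admissible[OF h] admissible_invariant_attained[OF h] by force
  have orbit: "{(\<sigma> ` fst x, \<sigma> (snd x)) | \<sigma>. isometry \<sigma> \<and> \<sigma> h = h} = fibre (?inv x)"
    if "x \<in> ?R" for x
  proof (cases x)
    case (Pair W w)
    show ?thesis
    proof (intro equalityI subsetI)
      fix y assume "y \<in> {(\<sigma> ` fst x, \<sigma> (snd x)) | \<sigma>. isometry \<sigma> \<and> \<sigma> h = h}"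
      then show "y \<in> fibre (?inv x)"
        using Reg_image[where W = W and w = w] that by (auto simp: fibre_def Pair)
    next
      fix y assume y: "y \<in> fibre (?inv x)"
      obtain W' w' where y': "y = (W', w')" by (cases y)
      have "\<exists>\<sigma>. isometry \<sigma> \<and> \<sigma> h = h \<and> \<sigma> ` W = W' \<and> \<sigma> w = w'"
        using y that Reg_transitive[OF h(2), of W w W' w'] by (simp add: fibre_def Pair y')
      then show "y \<in> {(\<sigma> ` fst x, \<sigma> (snd x)) | \<sigma>. isometry \<sigma> \<and> \<sigma> h = h}"
        by (auto simp: Pair y')
    qed
  qed
  have J: "J1 scale form h = (\<lambda>k. fibre (k, False, True, 0))"
    "J2 scale form h = (\<lambda>k. fibre (k, True, False, 0))"
    "y \<noteq> 0 \<Longrightarrow> J3 scale form h k y = fibre (k, False, False, y)"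
    "J4 scale form h = (\<lambda>k. fibre (k, False, False, 0))" for k y
    using J_as_fibres[OF h] by (auto simp: fibre_def fun_eq_iff)
  have J3: "{J3 scale form h k y | k y. k \<in> {1..dim UNIV - 1} \<and> y \<noteq> 0}
      = {fibre (k, False, False, y) | k y. k \<in> {1..dim UNIV - 1} \<and> y \<noteq> 0}"
    using J(3) by (intro Collect_cong ex_cong1) auto
  have "?orbits = (\<lambda>x. fibre (?inv x)) ` ?R"
    unfolding Setcompr_eq_image using orbit by (intro image_cong refl) simp
  also have "\<dots> = fibre ` ?inv ` ?R" by (simp add: image_image)
  also have J_eq: "\<dots> = ?J"
    unfolding inv admissible_invariants_def image_Un J3
    by (intro arg_cong2[where f = "(\<union>)"]) (auto simp: J(1,2,4) image_iff)
  finally show "?orbits = ?J" .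
  have "?R = \<Union> (fibre ` ?inv ` ?R)" by (auto simp: fibre_def)
  also have "\<dots> = ?U" unfolding J_eq Union_Un_distrib
    by (intro arg_cong2[where f = "(\<union>)"]) blast+
  finally show "?R = ?U" .
qed

end

section \<open>Wick contraction\<close>

text \<open>
  For every letter \<open>y\<close> of the word, \<open>q x y\<close> times the value of \<open>f\<close> at the word without that letter.
  The functional \<open>f\<close> is an argument so that \<open>wick\<close> below can call itself through it.
\<close>

fun contract :: "('g \<Rightarrow> 'g \<Rightarrow> complex) \<Rightarrow> 'g \<Rightarrow> 'g list \<Rightarrow> ('g list \<Rightarrow> complex) \<Rightarrow> complex" where
  "contract q x [] f = 0"
| "contract q x (y # ys) f = q x y * f ys + contract q x ys (\<lambda>zs. f (y # zs))"

text \<open>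
  Contraction evaluates \<open>f\<close> only at shorter words, which makes the recursion of \<open>wick\<close> terminate and
  lets the induction hypotheses below be used under a contraction.
\<close>

lemma contract_cong [fundef_cong]:
  assumes "q = q'" "x = x'" "xs = ys" "\<And>zs. length zs < length ys \<Longrightarrow> f zs = g zs"
  shows "contract q x xs f = contract q' x' ys g"
  using assms(4) unfolding assms(1-3)
proof (induction ys arbitrary: f g)
  case (Cons y ys)
  show ?case
    using Cons.prems by (auto intro!: arg_cong2[where f = "(+)"] Cons.IH)
qed simp

lemma contract_append:
  "contract q x (as @ bs) f =
    contract q x as (\<lambda>zs. f (zs @ bs)) + contract q x bs (\<lambda>zs. f (as @ zs))"
  by (induction as arbitrary: f) simp_all

lemma contract_linear:
  "contract q x xs (\<lambda>zs. f zs + g zs) = contract q x xs f + contract q x xs g"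
  "contract q x xs (\<lambda>zs. f zs - g zs) = contract q x xs f - contract q x xs g"
  "contract q x xs (\<lambda>zs. c * f zs) = c * contract q x xs f"
  by (induction xs arbitrary: f g) (simp_all add: algebra_simps)

lemma contract_commute:
  "contract q x zs (\<lambda>us. contract q y us f) = contract q y zs (\<lambda>us. contract q x us f)"
proof (induction zs arbitrary: f)
  case (Cons z zs)
  then show ?case by (simp add: contract_linear)
qed simp

lemma contract_zero:
  "(\<And>y. y \<in> set xs \<Longrightarrow> q x y = 0) \<Longrightarrow> contract q x xs f = 0"
  by (induction xs arbitrary: f) simp_all

text \<open>
  The recursion for the vacuum expectation value of a product of operators \<open>x = x\<^sub>- + chi x + x\<^sub>+\<close>,
  where the creation parts \<open>x\<^sub>-\<close> are killed by the dual vacuum on the left, the annihilation parts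
  \<open>x\<^sub>+\<close> by the vacuum on the right, and \<open>q x y\<close> is the commutator of \<open>x\<^sub>+\<close> with \<open>y\<^sub>-\<close>: the annihilation
  part of the leftmost letter is moved to the right end.
\<close>

function wick :: "('g \<Rightarrow> 'g \<Rightarrow> complex) \<Rightarrow> ('g \<Rightarrow> complex) \<Rightarrow> 'g list \<Rightarrow> complex" where
  "wick q chi [] = 1"
| "wick q chi (x # xs) = chi x * wick q chi xs + contract q x xs (wick q chi)"
  by pat_completeness auto
termination by (relation "measure (\<lambda>(q, chi, xs). length xs)") auto

lemma wick_linear:
  assumes "\<And>x y z. q x (y + z) = q x y + q x z" "\<And>x y z. q (x + y) z = q x z + q y z"
    and "\<And>x y. chi (x + y) = chi x + chi y"
  shows "wick q chi (as @ (x + y) # bs) = wick q chi (as @ x # bs) + wick q chi (as @ y # bs)"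
proof (induction "length as + length bs" arbitrary: as bs rule: less_induct)
  case less
  show ?case
  proof (cases as)
    case Nil
    have "contract q (x + y) bs f = contract q x bs f + contract q y bs f" for f
      by (induction bs arbitrary: f) (simp_all add: assms algebra_simps)
    then show ?thesis by (simp add: Nil assms algebra_simps)
  next
    case (Cons z as')
    have 1: "wick q chi (as' @ (x + y) # bs) = wick q chi (as' @ x # bs) + wick q chi (as' @ y # bs)"
      by (rule less) (simp add: Cons)
    have 2: "contract q z as' (\<lambda>zs. wick q chi (zs @ (x + y) # bs))
        = contract q z as' (\<lambda>zs. wick q chi (zs @ x # bs) + wick q chi (zs @ y # bs))"
      by (intro contract_cong refl less) (simp add: Cons)
    have 3: "contract q z bs (\<lambda>zs. wick q chi (as' @ (x + y) # zs))
        = contract q z bs (\<lambda>zs. wick q chi (as' @ x # zs) + wick q chi (as' @ y # zs))"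
      by (intro contract_cong refl less) (simp add: Cons)
    show ?thesis
      using 1 2 3 by (simp add: Cons contract_append contract_linear assms algebra_simps)
  qed
qed

lemma wick_scale:
  assumes "\<And>x y. q x (s y) = c * q x y" "\<And>x y. q (s x) y = c * q x y" "\<And>x. chi (s x) = c * chi x"
  shows "wick q chi (as @ s x # bs) = c * wick q chi (as @ x # bs)"
proof (induction "length as + length bs" arbitrary: as bs rule: less_induct)
  case less
  show ?case
  proof (cases as)
    case Nil
    have "contract q (s x) bs f = c * contract q x bs f" for f
      by (induction bs arbitrary: f) (simp_all add: assms algebra_simps)
    then show ?thesis by (simp add: Nil assms algebra_simps)
  next
    case (Cons z as')
    have 1: "wick q chi (as' @ s x # bs) = c * wick q chi (as' @ x # bs)"
      by (rule less) (simp add: Cons)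
    have 2: "contract q z as' (\<lambda>zs. wick q chi (zs @ s x # bs))
        = contract q z as' (\<lambda>zs. c * wick q chi (zs @ x # bs))"
      by (intro contract_cong refl less) (simp add: Cons)
    have 3: "contract q z bs (\<lambda>zs. wick q chi (as' @ s x # zs))
        = contract q z bs (\<lambda>zs. c * wick q chi (as' @ x # zs))"
      by (intro contract_cong refl less) (simp add: Cons)
    show ?thesis
      using 1 2 3 by (simp add: Cons contract_append contract_linear assms algebra_simps)
  qed
qed

text \<open>
  At the head of the word the double contractions of \<open>x\<close> and \<open>y\<close> with the rest cancel by
  \<open>contract_commute\<close>, and what remains is the contraction of \<open>x\<close> with \<open>y\<close> and of \<open>y\<close> with \<open>x\<close>. Under a
  prefix the claim is propagated through the recursion.
\<close>

lemma wick_commutator: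
  "wick q chi (as @ x # y # bs) - wick q chi (as @ y # x # bs) = (q x y - q y x) * wick q chi (as @ bs)"
proof (induction "length as + length bs" arbitrary: as bs rule: less_induct)
  case less
  show ?case
  proof (cases as)
    case Nil
    show ?thesis
      using contract_commute[of q x bs y "wick q chi"]
      by (simp add: Nil contract_linear algebra_simps)
  next
    case (Cons z as')
    have 1: "wick q chi (as' @ x # y # bs) - wick q chi (as' @ y # x # bs)
        = (q x y - q y x) * wick q chi (as' @ bs)"
      by (rule less) (simp add: Cons)
    have 2: "contract q z as' (\<lambda>zs. wick q chi (zs @ x # y # bs) - wick q chi (zs @ y # x # bs))
        = contract q z as' (\<lambda>zs. (q x y - q y x) * wick q chi (zs @ bs))"
      by (intro contract_cong refl less) (simp add: Cons)
    have 3: "contract q z bs (\<lambda>zs. wick q chi (as' @ x # y # zs) - wick q chi (as' @ y # x # zs))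
        = contract q z bs (\<lambda>zs. (q x y - q y x) * wick q chi (as' @ zs))"
      by (intro contract_cong refl less) (simp add: Cons)
    have "wick q chi (as @ x # y # bs) - wick q chi (as @ y # x # bs)
        = chi z * (wick q chi (as' @ x # y # bs) - wick q chi (as' @ y # x # bs))
          + contract q z as' (\<lambda>zs. wick q chi (zs @ x # y # bs) - wick q chi (zs @ y # x # bs))
          + contract q z bs (\<lambda>zs. wick q chi (as' @ x # y # zs) - wick q chi (as' @ y # x # zs))"
      by (simp add: Cons contract_append contract_linear algebra_simps)
    also have "\<dots> = (q x y - q y x) * wick q chi (as @ bs)"
      unfolding 1 2 3 by (simp add: Cons contract_append contract_linear algebra_simps)
    finally show ?thesis .
  qed
qed

text \<open>
  Letters with which nothing on their left can be contracted contribute only their character.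
\<close>

lemma wick_right_character:
  assumes "\<And>x p. p \<in> set ps \<Longrightarrow> q x p = 0"
  shows "wick q chi (us @ ps) = prod_list (map chi ps) * wick q chi us"
  using assms
proof (induction "length us + length ps" arbitrary: us ps rule: less_induct)
  case less
  show ?case
  proof (cases us)
    case Nil
    show ?thesis
    proof (cases ps)
      case (Cons p ps')
      have "wick q chi ([] @ ps') = prod_list (map chi ps') * wick q chi []"
        by (rule less) (auto simp: Nil Cons less.prems)
      moreover have "contract q p ps' (wick q chi) = 0"
        by (rule contract_zero) (simp add: less.prems Cons)
      ultimately show ?thesis by (simp add: Nil Cons)
    qed (simp add: Nil)
  next
    case (Cons z us')
    have 1: "wick q chi (us' @ ps) = prod_list (map chi ps) * wick q chi us'"
      by (rule less) (auto simp: Cons less.prems)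
    have 2: "contract q z us' (\<lambda>zs. wick q chi (zs @ ps))
        = contract q z us' (\<lambda>zs. prod_list (map chi ps) * wick q chi zs)"
      by (intro contract_cong refl less) (auto simp: Cons less.prems)
    have 3: "contract q z ps f = 0" for f
      by (rule contract_zero) (simp add: less.prems)
    show ?thesis using 1 2 3 by (simp add: Cons contract_append contract_linear algebra_simps)
  qed
qed

section \<open>The vacuum is not zero\<close>

lemma lookup_free_scale: "Poly_Mapping.lookup (free_scale c p) xs = c * Poly_Mapping.lookup p xs"
  by (simp add: free_scale_def Poly_Mapping.map.rep_eq when_def)

lemma vector_space_free_scale: "vector_space free_scale"
  by unfold_locales (auto intro!: poly_mapping_eqI simp: lookup_free_scale lookup_add algebra_simps)

interpretation free_alg: vector_space free_scale
  by (rule vector_space_free_scale)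

locale complex_vector_space = vector_space vscale
  for vscale :: "complex \<Rightarrow> 'v::ab_group_add \<Rightarrow> 'v"
begin

definition free_extend :: "('g list \<Rightarrow> 'v) \<Rightarrow> 'g free_alg \<Rightarrow> 'v" where
  "free_extend f p = (\<Sum>xs\<in>Poly_Mapping.keys p. vscale (Poly_Mapping.lookup p xs) (f xs))"

lemma free_extend_superset:
  assumes "finite A" "Poly_Mapping.keys p \<subseteq> A"
  shows "free_extend f p = (\<Sum>xs\<in>A. vscale (Poly_Mapping.lookup p xs) (f xs))"
  unfolding free_extend_def using assms
  by (intro sum.mono_neutral_left) (auto simp: in_keys_iff)

lemma free_extend_add: "free_extend f (p + q) = free_extend f p + free_extend f q"
proof -
  let ?A = "Poly_Mapping.keys p \<union> Poly_Mapping.keys q"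
  have "free_extend f r = (\<Sum>xs\<in>?A. vscale (Poly_Mapping.lookup r xs) (f xs))"
    if "Poly_Mapping.keys r \<subseteq> ?A" for r using that by (intro free_extend_superset) auto
  then show ?thesis
    using keys_add[of p q] by (simp add: lookup_add scale_left_distrib sum.distrib)
qed

lemma free_extend_scale: "free_extend f (free_scale c p) = vscale c (free_extend f p)"
proof -
  have "Poly_Mapping.keys (free_scale c p) \<subseteq> Poly_Mapping.keys p"
    by (auto simp: in_keys_iff lookup_free_scale)
  then have "free_extend f (free_scale c p)
      = (\<Sum>xs\<in>Poly_Mapping.keys p. vscale (c * Poly_Mapping.lookup p xs) (f xs))"
    by (subst free_extend_superset[of "Poly_Mapping.keys p"]) (auto simp: lookup_free_scale)
  then show ?thesis by (simp add: free_extend_def scale_sum_right)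
qed

lemma free_extend_diff: "free_extend f (p - q) = free_extend f p - free_extend f q"
  using free_extend_add[of f "p - q" q] by simp

lemma free_extend_word: "free_extend f (word xs) = f xs"
  by (simp add: free_extend_def word_def)

lemmas free_extend_simps = free_extend_add free_extend_diff free_extend_scale free_extend_word

lemma free_extend_span_zero:
  assumes "p \<in> free_alg.span R" "\<And>r. r \<in> R \<Longrightarrow> free_extend f r = 0"
  shows "free_extend f p = 0"
  using assms(1)
proof (induction rule: free_alg.span_induct)
  case base
  have "free_extend f 0 = 0" using free_extend_diff[of f 0 0] by simp
  then show ?case by (simp add: free_alg.subspace_def free_extend_simps)
qed (use assms(2) in simp)

end

context quadratic_space
begin

text \<open>
  The commutator of the annihilation part of \<open>x\<close> with the creation part of \<open>y\<close>.
\<close>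

definition positive_pairing :: "'h heis \<Rightarrow> 'h heis \<Rightarrow> complex" where
  "positive_pairing x y = (\<Sum>m\<in>{m\<in>Poly_Mapping.keys (fst x). 0 < m}.
      of_int m * form (Poly_Mapping.lookup (fst x) m) (Poly_Mapping.lookup (fst y) (- m)))"

lemma positive_pairing_superset:
  assumes "finite A" "Poly_Mapping.keys (fst x) \<subseteq> A"
  shows "positive_pairing x y = (\<Sum>m\<in>{m\<in>A. 0 < m}.
      of_int m * form (Poly_Mapping.lookup (fst x) m) (Poly_Mapping.lookup (fst y) (- m)))"
  unfolding positive_pairing_def using assms
  by (intro sum.mono_neutral_left) (auto simp: in_keys_iff)

lemma lookup_heis_scale:
  "Poly_Mapping.lookup (fst (heis_scale scale c x)) n = scale c (Poly_Mapping.lookup (fst x) n)"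
  by (simp add: heis_scale_def Poly_Mapping.map.rep_eq when_def)

lemma positive_pairing_linear:
  "positive_pairing x (y + z) = positive_pairing x y + positive_pairing x z"
  "positive_pairing (x + y) z = positive_pairing x z + positive_pairing y z"
  "positive_pairing x (heis_scale scale c y) = c * positive_pairing x y"
  "positive_pairing (heis_scale scale c x) y = c * positive_pairing x y"
proof -
  show "positive_pairing x (y + z) = positive_pairing x y + positive_pairing x z"
    by (simp add: positive_pairing_def lookup_add form_simps algebra_simps sum.distrib)
  show "positive_pairing x (heis_scale scale c y) = c * positive_pairing x y"
    by (simp add: positive_pairing_def lookup_heis_scale form_simps sum_distrib_left algebra_simps)
  have "Poly_Mapping.keys (fst (heis_scale scale c x)) \<subseteq> Poly_Mapping.keys (fst x)"
    by (auto simp: in_keys_iff lookup_heis_scale)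
  from positive_pairing_superset[OF _ this]
  show "positive_pairing (heis_scale scale c x) y = c * positive_pairing x y"
    by (simp add: positive_pairing_def lookup_heis_scale form_simps sum_distrib_left algebra_simps)
  let ?A = "Poly_Mapping.keys (fst x) \<union> Poly_Mapping.keys (fst y)"
  show "positive_pairing (x + y) z = positive_pairing x z + positive_pairing y z"
    using keys_add[of "fst x" "fst y"]
    by (simp add: positive_pairing_superset[of ?A] lookup_add form_simps algebra_simps sum.distrib)
qed

lemma heis_bracket_positive_pairing:
  "heis_bracket form x y = (0, positive_pairing x y - positive_pairing y x)"
proof -
  let ?t = "\<lambda>m. of_int m * form (Poly_Mapping.lookup (fst x) m) (Poly_Mapping.lookup (fst y) (- m))"
  define S where "S = Poly_Mapping.keys (fst x) \<union> uminus ` Poly_Mapping.keys (fst y)"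
  have S: "finite S" by (simp add: S_def)
  have "(\<Sum>m\<in>Poly_Mapping.keys (fst x). ?t m) = (\<Sum>m\<in>S. ?t m)"
    using S by (intro sum.mono_neutral_left) (auto simp: S_def in_keys_iff)
  also have "\<dots> = (\<Sum>m\<in>{m\<in>S. 0 < m} \<union> {m\<in>S. m < 0}. ?t m)"
    using S by (intro sum.mono_neutral_right) auto
  also have "\<dots> = (\<Sum>m\<in>{m\<in>S. 0 < m}. ?t m) + (\<Sum>m\<in>{m\<in>S. m < 0}. ?t m)"
    using S by (intro sum.union_disjoint) auto
  also have "(\<Sum>m\<in>{m\<in>S. 0 < m}. ?t m) = positive_pairing x y"
    using S by (simp add: positive_pairing_superset[of S] S_def)
  also have "(\<Sum>m\<in>{m\<in>S. m < 0}. ?t m) = - positive_pairing y x"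
  proof -
    have "Poly_Mapping.keys (fst y) \<subseteq> uminus ` S" by (force simp: S_def)
    then have "positive_pairing y x = (\<Sum>m\<in>{m\<in>uminus ` S. 0 < m}.
        of_int m * form (Poly_Mapping.lookup (fst y) m) (Poly_Mapping.lookup (fst x) (- m)))"
      using S by (intro positive_pairing_superset) auto
    also have "\<dots> = (\<Sum>m\<in>{m\<in>S. m < 0}. - ?t m)"
      by (intro sum.reindex_bij_witness[of _ uminus uminus]) (auto simp: form_sym)
    finally show ?thesis by (simp add: sum_negf)
  qed
  finally show ?thesis by (simp add: heis_bracket_def)
qed

lemma positive_pairing_nonneg: "p \<in> heis_nonneg \<Longrightarrow> positive_pairing x p = 0"
  by (auto simp: positive_pairing_def heis_nonneg_def intro!: sum.neutral)

abbreviation vacuum_expectation :: "'h heis list \<Rightarrow> complex" where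
  "vacuum_expectation \<equiv> wick positive_pairing snd"

text \<open>
  A central letter can be moved to the end of the word at no cost, where it acts by its scalar.
\<close>

lemma vacuum_expectation_central:
  assumes "fst z = 0"
  shows "vacuum_expectation (xs @ z # ys) = snd z * vacuum_expectation (xs @ ys)"
proof (induction ys arbitrary: xs)
  case Nil
  have "positive_pairing x z = 0" for x using assms by (simp add: positive_pairing_def)
  then show ?case using wick_right_character[of "[z]" positive_pairing snd xs] by simp
next
  case (Cons y ys)
  have "positive_pairing z y - positive_pairing y z = 0"
    using assms by (simp add: positive_pairing_def)
  then have "vacuum_expectation (xs @ z # y # ys) = vacuum_expectation ((xs @ [y]) @ z # ys)"
    using wick_commutator[of positive_pairing snd xs z y ys] by simp
  then show ?case using Cons.IH[of "xs @ [y]"] by simp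
qed

text \<open>
  The linear extension of the vacuum expectation value kills all defining relations and takes the
  value 1 at the empty word.
\<close>

lemma word_Nil_not_relation:
  "word [] \<notin> module.span free_scale
     (uea_relations (heis_scale scale) (heis_bracket form) \<union> tensor_relations heis_nonneg snd)"
    (is "_ \<notin> free_alg.span ?R")
proof
  interpret C: complex_vector_space "(*) :: complex \<Rightarrow> complex \<Rightarrow> complex"
    by unfold_locales (auto simp: algebra_simps)
  assume "word [] \<in> free_alg.span ?R"
  then have "C.free_extend vacuum_expectation (word []) = 0"
  proof (rule C.free_extend_span_zero)
    have add: "vacuum_expectation (xs @ (x + y) # ys)
        = vacuum_expectation (xs @ x # ys) + vacuum_expectation (xs @ y # ys)" for xs x y ys
      by (intro wick_linear positive_pairing_linear) simp
    have add': "vacuum_expectation (xs @ (a + a', c + c') # ys)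
        = vacuum_expectation (xs @ (a, c) # ys) + vacuum_expectation (xs @ (a', c') # ys)"
      for xs ys a a' c c'
      using add[of xs "(a, c)" "(a', c')" ys] by simp
    have scal: "vacuum_expectation (xs @ heis_scale scale c x # ys)
        = c * vacuum_expectation (xs @ x # ys)" for xs x ys c
      by (intro wick_scale positive_pairing_linear) (simp add: heis_scale_def)
    have comm: "vacuum_expectation (xs @ x # y # ys) - vacuum_expectation (xs @ y # x # ys)
        - vacuum_expectation (xs @ heis_bracket form x y # ys) = 0" for xs x y ys
      by (simp add: wick_commutator vacuum_expectation_central heis_bracket_positive_pairing)
    have tens: "vacuum_expectation (us @ ps) = prod_list (map snd ps) * vacuum_expectation us"
      if "set ps \<subseteq> heis_nonneg" for us ps
      using that by (intro wick_right_character positive_pairing_nonneg) auto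
    fix r assume "r \<in> ?R"
    then show "C.free_extend vacuum_expectation r = 0"
      by (auto simp: uea_relations_def tensor_relations_def C.free_extend_simps add' scal comm tens)
  qed
  then show False by (simp add: C.free_extend_word)
qed

end

section \<open>Modes on the vacuum module\<close>

locale heisenberg_va =
  H: quadratic_space scale form + V: vertex_algebra vscale vac Y
  for scale :: "complex \<Rightarrow> 'h::ab_group_add \<Rightarrow> 'h" and form
    and vscale :: "complex \<Rightarrow> 'v::ab_group_add \<Rightarrow> 'v" and vac and Y +
  fixes act :: "'h heis \<Rightarrow> 'v \<Rightarrow> 'v"
  assumes heisenberg: "heisenberg_vertex_algebra scale form vscale act vac Y"

sublocale heisenberg_va \<subseteq> CV: complex_vector_space vscale
  by unfold_locales

context heisenberg_va
begin

lemma induced: "induced_module (heis_scale scale) (heis_bracket form) heis_nonneg snd vscale act vac"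
  using heisenberg by (simp add: heisenberg_vertex_algebra_def)

definition state :: "'h \<Rightarrow> 'v" where "state u = act (loop u (-1)) vac"

lemma state_modes: "Y (state u) n v = act (loop u n) v"
  using heisenberg by (simp add: heisenberg_vertex_algebra_def state_def)

lemma act_add: "act x (v + w) = act x v + act x w"
  and act_scale: "act x (vscale c v) = vscale c (act x v)"
  and act_plus: "act (x + y) v = act x v + act y v"
  and act_heis_scale: "act (heis_scale scale c x) v = vscale c (act x v)"
  and act_bracket: "act (heis_bracket form x y) v = act x (act y v) - act y (act x v)"
  using induced unfolding induced_module_def Vector_Spaces.linear_iff by blast+

lemma act_zero [simp]: "act x 0 = 0" "act 0 v = 0"
  using act_add[of x 0 0] act_plus[of 0 0 v] by simp_all

lemma act_sum: "act x (\<Sum>i\<in>I. f i) = (\<Sum>i\<in>I. act x (f i))"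
  by (induction I rule: infinite_finite_induct) (auto simp: act_add)

lemma act_sum_left: "act (\<Sum>i\<in>I. f i) v = (\<Sum>i\<in>I. act (f i) v)"
  by (induction I rule: infinite_finite_induct) (auto simp: act_plus)

lemma Y_add_left: "Y (a + b) n c = Y a n c + Y b n c"
  and Y_scale_left: "Y (vscale k a) n c = vscale k (Y a n c)"
  using V.linear_left[of n c] by (auto simp: Vector_Spaces.linear_iff)

lemma Y_add_right: "Y a n (b + c) = Y a n b + Y a n c"
  and Y_scale_right: "Y a n (vscale k b) = vscale k (Y a n b)"
  using V.linear_right[of a n] by (auto simp: Vector_Spaces.linear_iff)

lemma Y_zero [simp]: "Y 0 n c = 0" "Y a n 0 = 0"
  using Y_add_left[of 0 0 n c] Y_add_right[of a n 0 0] by simp_all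

lemma Y_sum_left: "Y (\<Sum>i\<in>I. f i) n c = (\<Sum>i\<in>I. Y (f i) n c)"
  by (induction I rule: infinite_finite_induct) (auto simp: Y_add_left)

lemma word_action_eq: "word_action vscale act vac = CV.free_extend (\<lambda>xs. foldr act xs vac)"
  by (simp add: word_action_def CV.free_extend_def fun_eq_iff)

lemma kernel: "word_action vscale act vac p = 0 \<longleftrightarrow> p \<in> module.span free_scale
     (uea_relations (heis_scale scale) (heis_bracket form) \<union> tensor_relations heis_nonneg snd)"
  using induced by (auto simp: induced_module_def)

lemma vac_nonzero: "vac \<noteq> 0"
proof
  assume "vac = 0"
  moreover have "word_action vscale act vac (word []) = vac"
    by (simp add: word_action_eq CV.free_extend_word)
  ultimately show False using kernel H.word_Nil_not_relation by blast
qed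

lemma vac_scale_cancel: "vscale a vac = vscale b vac \<Longrightarrow> a = b"
  using vac_nonzero V.scale_cancel_right by blast

lemma act_vac: "x \<in> heis_nonneg \<Longrightarrow> act x vac = vscale (snd x) vac"
proof -
  assume x: "x \<in> heis_nonneg"
  let ?r = "word ([] @ [x]) - free_scale (prod_list (map snd [x])) (word [])"
  have "?r \<in> tensor_relations heis_nonneg snd"
    unfolding tensor_relations_def using x by (intro CollectI exI[of _ "[]"] exI[of _ "[x]"]) auto
  then have "word_action vscale act vac ?r = 0"
    unfolding kernel by (intro free_alg.span_base) auto
  then show ?thesis by (simp add: word_action_eq CV.free_extend_simps)
qed

lemma words_span: "v \<in> V.span (range (\<lambda>xs. foldr act xs vac))"
proof -
  obtain p where "v = word_action vscale act vac p"
    using induced by (metis induced_module_def surjD)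
  then show ?thesis
    unfolding word_action_def
    by (simp only:) (intro V.span_sum V.span_scale V.span_base rangeI)
qed

lemma module_induct:
  assumes "V.subspace S" "vac \<in> S" "\<And>x v. v \<in> S \<Longrightarrow> act x v \<in> S"
  shows "v \<in> S"
proof -
  have "foldr act xs vac \<in> S" for xs by (induction xs) (auto intro: assms)
  then have "V.span (range (\<lambda>xs. foldr act xs vac)) \<subseteq> S"
    by (intro V.span_minimal assms(1)) auto
  then show ?thesis using words_span by blast
qed

text \<open>
  Central elements commute with the whole action and act on the vacuum by the character.
\<close>

lemma act_central: "act (0, c) v = vscale c v"
proof -
  let ?S = "{v. act (0, c) v = vscale c v}"
  have "v \<in> ?S"
  proof (rule module_induct)
    show "V.subspace ?S"
      by (auto simp: V.subspace_def act_add act_scale V.scale_right_distrib)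
    show "vac \<in> ?S" using act_vac[of "(0, c)"] by (simp add: heis_nonneg_def)
    fix x v assume "v \<in> ?S"
    moreover have "heis_bracket form (0, c) x = 0" by (simp add: heis_bracket_def zero_prod_def)
    ultimately show "act x v \<in> ?S" using act_bracket[of "(0, c)" x v] by (simp add: act_scale)
  qed
  then show ?thesis by simp
qed

lemma fst_sum_loop: "fst (\<Sum>n\<in>I. loop (f n) n) = (\<Sum>n\<in>I. Poly_Mapping.single n (f n))"
  and snd_sum_loop: "snd (\<Sum>n\<in>I. loop (f n) n) = 0"
  by (induction I rule: infinite_finite_induct) (auto simp: loop_def)

lemma heis_decomp:
  "(\<Sum>n\<in>Poly_Mapping.keys (fst x). loop (Poly_Mapping.lookup (fst x) n) n) + (0, snd x) = x"
proof -
  have "(\<Sum>n\<in>Poly_Mapping.keys (fst x). Poly_Mapping.single n (Poly_Mapping.lookup (fst x) n)) = fst x"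
    by (intro poly_mapping_eqI) (auto simp: lookup_sum lookup_single when_def in_keys_iff sum.delta)
  then show ?thesis
    by (intro prod_eqI) 
      (simp_all only: fst_add snd_add fst_sum_loop snd_sum_loop fst_conv snd_conv add_0_left add_0_right)
qed

lemma act_decomp:
  "act x v = (\<Sum>n\<in>Poly_Mapping.keys (fst x). act (loop (Poly_Mapping.lookup (fst x) n) n) v)
     + vscale (snd x) v"
  by (subst heis_decomp[symmetric]) (simp add: act_plus act_sum_left act_central)

text \<open>
  A Lie algebra element is a finite sum of the modes \<open>u(n)\<close> and a central element, and the latter
  acts as a scalar.
\<close>

lemma mode_induct:
  assumes "V.subspace S" "vac \<in> S" "\<And>u n v. v \<in> S \<Longrightarrow> act (loop u n) v \<in> S"
  shows "v \<in> S"
proof (rule module_induct[OF assms(1,2)])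
  fix x v assume "v \<in> S"
  then show "act x v \<in> S"
    unfolding act_decomp[of x v]
    by (intro V.subspace_add[OF assms(1)] V.subspace_sum[OF assms(1)] V.subspace_scale[OF assms(1)] assms(3))
qed

lemma loop_add: "loop (u + v) n = loop u n + loop v n"
  by (simp add: loop_def single_add)

lemma loop_scale: "loop (scale c u) n = heis_scale scale c (loop u n)"
  by (auto simp: loop_def heis_scale_def lookup_single when_def Poly_Mapping.map.rep_eq
      intro!: poly_mapping_eqI)

lemma mode_add: "act (loop (u + v) n) w = act (loop u n) w + act (loop v n) w"
  and mode_scale: "act (loop (scale c u) n) w = vscale c (act (loop u n) w)"
  by (simp_all add: loop_add loop_scale act_plus act_heis_scale)

lemma mode_sum: "act (loop (\<Sum>i\<in>I. f i) n) w = (\<Sum>i\<in>I. act (loop (f i) n) w)"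
proof (induction I rule: infinite_finite_induct)
  case empty
  have "loop (0::'h) n = 0" by (simp add: loop_def zero_prod_def)
  then show ?case by simp
next
  case (infinite A)
  have "loop (0::'h) n = 0" by (simp add: loop_def zero_prod_def)
  with infinite show ?case by simp
qed (simp add: mode_add)

lemma mode_commute:
  "act (loop u m) (act (loop v n) w)
     = act (loop v n) (act (loop u m) w) + (if m + n = 0 then vscale (of_int m * form u v) w else 0)"
proof -
  have "heis_bracket form (loop u m) (loop v n) = (0, if m + n = 0 then of_int m * form u v else 0)"
    by (auto simp: heis_bracket_def loop_def lookup_single when_def)
  then have "act (loop u m) (act (loop v n) w) - act (loop v n) (act (loop u m) w)
      = vscale (if m + n = 0 then of_int m * form u v else 0) w"
    using act_bracket[of "loop u m" "loop v n" w] by (simp only: act_central)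
  then show ?thesis by (simp add: diff_eq_eq add.commute split: if_splits)
qed

lemma mode_vac: "0 \<le> n \<Longrightarrow> act (loop u n) vac = 0"
  using act_vac[of "loop u n"] by (simp add: heis_nonneg_def loop_def lookup_single when_def)

text \<open>
  The zero mode commutes with all modes and kills the vacuum.
\<close>

lemma mode_zero: "act (loop u 0) v = 0"
proof -
  have "v \<in> {v. act (loop u 0) v = 0}"
  proof (rule mode_induct)
    show "V.subspace {v. act (loop u 0) v = 0}"
      by (auto simp: V.subspace_def act_add act_scale)
    fix w n v assume "v \<in> {v. act (loop u 0) v = 0}"
    then show "act (loop w n) v \<in> {v. act (loop u 0) v = 0}"
      using mode_commute[of u 0 w n v] by (simp split: if_splits)
  qed (simp add: mode_vac)
  then show ?thesis by simp
qed

lemma state_pairing: "act (loop u 1) (state v) = vscale (form u v) vac"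
  using mode_commute[of u 1 v "-1" vac] by (simp add: state_def mode_vac)

lemma state_inj: "state u = state v \<Longrightarrow> u = v"
proof -
  assume "state u = state v"
  then have "form w u = form w v" for w using state_pairing vac_scale_cancel by metis
  then have "form (u - v) w = 0" for w by (simp add: H.form_sym[of "u - v"] H.form_diff_right)
  then have "u - v = 0" by (rule H.form_nondegenerate)
  then show "u = v" by simp
qed

lemma state_add: "state (u + v) = state u + state v"
  and state_scale: "state (scale c u) = vscale c (state u)"
  by (simp_all add: state_def mode_add mode_scale)

text \<open>
  The Jacobi identity for \<open>m = 0\<close>. All large \<open>N\<close> are allowed, so that the formulas for several vectors
  can be truncated at the same place.
\<close>

lemma iterate_formula:
  "\<exists>N0. \<forall>N\<ge>N0. Y (Y a n b) k c = (\<Sum>i<N. vscale ((-1) ^ i * (of_int n gchoose i))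
      (Y a (n - int i) (Y b (k + int i) c)
       - vscale ((-1) powi n) (Y b (n + k - int i) (Y a (int i) c))))"
proof -
  let ?t = "\<lambda>i. vscale ((-1) ^ i * (of_int n gchoose i))
      (Y a (n - int i) (Y b (k + int i) c)
       - vscale ((-1) powi n) (Y b (n + k - int i) (Y a (int i) c)))"
  obtain N1 where N1: "\<And>m. N1 \<le> m \<Longrightarrow> Y b m c = 0" using V.truncation by blast
  obtain N2 where N2: "\<And>m. N2 \<le> m \<Longrightarrow> Y a m c = 0" using V.truncation by blast
  have vanish: "?t i = 0" if "nat (max (N1 - k) N2) \<le> i" for i
    using that N1[of "k + int i"] N2[of "int i"] by simp
  have "Sum_any (\<lambda>i::nat. vscale (of_int 0 gchoose i) (Y (Y a (n + int i) b) (0 + k - int i) c))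
      = (\<Sum>i\<in>{0}. vscale (of_int 0 gchoose i) (Y (Y a (n + int i) b) (0 + k - int i) c))"
  proof (rule Sum_any.expand_superset)
    show "{i::nat. vscale (of_int 0 gchoose i) (Y (Y a (n + int i) b) (0 + k - int i) c) \<noteq> 0} \<subseteq> {0}"
      by (auto simp: gbinomial_0_left split: if_splits)
  qed simp
  then have lhs: "Y (Y a n b) k c = Sum_any ?t"
    using V.jacobi[of 0 a n b k c] by simp
  have "Sum_any ?t = (\<Sum>i<N. ?t i)" if "nat (max (N1 - k) N2) \<le> N" for N
  proof (rule Sum_any.expand_superset)
    show "{i. ?t i \<noteq> 0} \<subseteq> {..<N}"
    proof
      fix i assume i: "i \<in> {i. ?t i \<noteq> 0}"
      show "i \<in> {..<N}"
      proof (rule ccontr)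
        assume "i \<notin> {..<N}"
        then have "?t i = 0" using that by (intro vanish) simp
        with i show False by simp
      qed
    qed
  qed simp
  with lhs show ?thesis by auto
qed

end

lemma (in quadratic_space) basis_expansion:
  assumes "orthonormal_basis scale form E"
  shows "(\<Sum>e\<in>E. scale (form v e) e) = v"
proof -
  have E: "finite E" "span E = UNIV" "\<And>e e'. e \<in> E \<Longrightarrow> e' \<in> E \<Longrightarrow> form e e' = (if e = e' then 1 else 0)"
    using assms by (auto simp: orthonormal_basis_def)
  have "v \<in> span E" using E by simp
  then show ?thesis
  proof (induction rule: span_induct)
    case base
    show ?case
      unfolding subspace_def
      by (auto simp: form_simps scale_left_distrib sum.distrib simp flip: scale_scale scale_sum_right)
  next
    case (step x)
    have "(\<Sum>e\<in>E. scale (form x e) e) = (\<Sum>e\<in>E. if e = x then x else 0)"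
      using step by (intro sum.cong) (auto simp: E(3))
    then show ?case using E(1) step by simp
  qed
qed

lemma gbinomial_minus_one: "((-1)::complex) gchoose i = (-1) ^ i"
  using gbinomial_minus[of "1::complex" i] by (simp add: binomial_gbinomial[symmetric])

section \<open>The weight-one space\<close>

locale heisenberg_conformal = heisenberg_va scale form vscale vac Y act
  for scale :: "complex \<Rightarrow> 'h::ab_group_add \<Rightarrow> 'h" and form
    and vscale :: "complex \<Rightarrow> 'v::ab_group_add \<Rightarrow> 'v" and vac and Y and act +
  fixes E :: "'h set" and h :: 'h
  assumes basis: "orthonormal_basis scale form E"
begin

definition conf :: 'v where "conf = omega vscale act vac E h"

text \<open>
  The zero mode of the Virasoro algebra, i.e. the weight operator.
\<close>

definition L :: "'v \<Rightarrow> 'v" where "L v = Y conf 1 v"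

lemma conf_eq:
  "conf = vscale (1/2) (\<Sum>e\<in>E. act (loop e (-1)) (state e)) + act (loop h (-2)) vac"
  by (simp add: conf_def omega_def state_def)

lemma L_add: "L (v + w) = L v + L w" and L_scale: "L (vscale c v) = vscale c (L v)"
  by (simp_all add: L_def Y_add_right Y_scale_right)

lemma L_diff: "L (v - w) = L v - L w"
  using L_add[of "v - w" w] by simp

text \<open>
  The iterate formula gives \<open>\<Sum>\<^sub>i e(-1-i)e(1+i) + \<Sum>\<^sub>i e(-i)e(i)\<close>. As \<open>e(0) = 0\<close>, the second sum is the
  first one shifted by one; the last term of the longer sum vanishes by truncation.
\<close>

lemma quadratic_mode:
  "\<exists>N0. \<forall>N\<ge>N0. Y (act (loop e (-1)) (state e)) 1 v
     = vscale 2 (\<Sum>i<N. act (loop e (- 1 - int i)) (act (loop e (1 + int i)) v))"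
proof -
  define A where "A i = act (loop e (- 1 - int i)) (act (loop e (1 + int i)) v)" for i
  define B where "B i = act (loop e (- int i)) (act (loop e (int i)) v)" for i
  obtain N1 where N1: "\<And>m. N1 \<le> m \<Longrightarrow> act (loop e m) v = 0"
    using V.truncation[of "state e" v] by (auto simp: state_modes)
  obtain N0 where N0: "\<And>N. N0 \<le> N \<Longrightarrow> Y (Y (state e) (- 1) (state e)) 1 v = (\<Sum>i<N. A i + B i)"
    using iterate_formula[of "state e" "-1" "state e" 1 v]
    by (auto simp: state_modes A_def B_def gbinomial_minus_one power_mult_distrib[symmetric])
  have "Y (act (loop e (-1)) (state e)) 1 v = vscale 2 (\<Sum>i<N. A i)" if "max N0 (nat N1) \<le> N" for N
  proof -
    have "B (Suc i) = A i" for i by (simp add: A_def B_def)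
    moreover have "B 0 = 0" by (simp add: B_def mode_zero)
    ultimately have "(\<Sum>i<Suc N. B i) = (\<Sum>i<N. A i)"
      by (simp only: sum.lessThan_Suc_shift add_0_left)
    moreover have "N1 \<le> 1 + int N" using that by linarith
    then have "A N = 0" using N1 by (simp add: A_def)
    ultimately have "(\<Sum>i<Suc N. A i + B i) = (\<Sum>i<N. A i) + (\<Sum>i<N. A i)"
      by (simp only: sum.distrib) simp
    also have "\<dots> = vscale (1 + 1) (\<Sum>i<N. A i)" by (simp only: V.scale_left_distrib V.scale_one)
    finally show ?thesis using N0[of "Suc N"] that by (simp add: state_modes)
  qed
  then show ?thesis unfolding A_def by blast
qed

lemma quadratic_mode_commute:
  assumes "1 \<le> m"
  shows "Y (act (loop e (-1)) (state e)) 1 (act (loop u (- int m)) v)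
    = act (loop u (- int m)) (Y (act (loop e (-1)) (state e)) 1 v)
      + vscale (2 * (of_nat m * form u e)) (act (loop e (- int m)) v)"
proof -
  let ?u = "act (loop u (- int m))"
  define T where "T i w = act (loop e (- 1 - int i)) (act (loop e (1 + int i)) w)" for i w
  obtain N1 where N1: "\<And>N. N1 \<le> N \<Longrightarrow>
      Y (act (loop e (-1)) (state e)) 1 v = vscale 2 (\<Sum>i<N. T i v)"
    using quadratic_mode[of e v] unfolding T_def by blast
  obtain N2 where N2: "\<And>N. N2 \<le> N \<Longrightarrow>
      Y (act (loop e (-1)) (state e)) 1 (?u v) = vscale 2 (\<Sum>i<N. T i (?u v))"
    using quadratic_mode[of e "?u v"] unfolding T_def by blast
  \<comment> \<open>A common truncation which includes the index \<open>m - 1\<close> of the only non-commuting summand.\<close>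
  define N where "N = Suc (max (max N1 N2) m)"
  have T: "T i (?u v) = ?u (T i v)
      + (if i = m - 1 then vscale (of_nat m * form u e) (act (loop e (- int m)) v) else 0)" for i
  proof -
    have eq: "1 + int i + - int m = 0 \<longleftrightarrow> i = m - 1" using assms by auto
    have "act (loop e (1 + int i)) (?u v) = ?u (act (loop e (1 + int i)) v)
        + (if i = m - 1 then vscale (of_nat m * form u e) v else 0)"
      using mode_commute[of e "1 + int i" u "- int m" v] assms
      unfolding eq by (auto simp: H.form_sym of_nat_diff)
    moreover have "act (loop e (- 1 - int i)) (?u w) = ?u (act (loop e (- 1 - int i)) w)" for w
      using mode_commute[of e "- 1 - int i" u "- int m" w] by simp
    ultimately show ?thesis using assms by (auto simp: T_def act_add act_scale of_nat_diff)
  qed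
  have "m - 1 < N" "N1 \<le> N" "N2 \<le> N" by (simp_all add: N_def)
  then have "(\<Sum>i<N. T i (?u v))
      = ?u (\<Sum>i<N. T i v) + vscale (of_nat m * form u e) (act (loop e (- int m)) v)"
    by (simp add: T sum.distrib act_sum sum.delta)
  then show ?thesis
    using N1[OF \<open>N1 \<le> N\<close>] N2[OF \<open>N2 \<le> N\<close>] by (simp add: act_scale V.scale_right_distrib)
qed

text \<open>
  The first mode of \<open>u(-2)vac\<close> is \<open>- u(0) = 0\<close>, so the summand \<open>h(-2)vac\<close> of the conformal vector
  does not change the weights.
\<close>

lemma translation_mode: "Y (act (loop u (-2)) vac) 1 v = 0"
proof -
  obtain N where "Y (Y (state u) (-2) vac) 1 v = (\<Sum>i<N. vscale ((-1) ^ i * (of_int (-2) gchoose i))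
      (Y (state u) (-2 - int i) (Y vac (1 + int i) v)
       - vscale ((-1) powi (-2)) (Y vac (-2 + 1 - int i) (Y (state u) (int i) v))))"
    using iterate_formula[of "state u" "-2" vac 1 v] by blast
  also have "\<dots> = 0"
  proof (rule sum.neutral, rule ballI)
    fix i
    have "Y vac (-2 + 1 - int i) (Y (state u) (int i) v) = 0"
      by (cases "i = 0") (auto simp: V.vacuum state_modes mode_zero)
    then show "vscale ((-1) ^ i * (of_int (-2) gchoose i))
      (Y (state u) (-2 - int i) (Y vac (1 + int i) v)
       - vscale ((-1) powi (-2)) (Y vac (-2 + 1 - int i) (Y (state u) (int i) v))) = 0"
      by (simp add: V.vacuum)
  qed
  finally show ?thesis by (simp add: state_modes)
qed

lemma L_eq: "L v = vscale (1/2) (\<Sum>e\<in>E. Y (act (loop e (-1)) (state e)) 1 v)"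
  by (simp add: L_def conf_eq Y_add_left Y_scale_left Y_sum_left translation_mode)

lemma L_vac: "L vac = 0"
  by (simp add: L_def V.creation)

text \<open>
  Only the summand \<open>e(-m)e(m)\<close> of \<open>L\<close> fails to commute with \<open>u(-m)\<close>, and the commutators add up to
  \<open>m \<Sum>\<^sub>e \<langle>u,e\<rangle> e(-m) = m u(-m)\<close>.
\<close>

lemma L_commute:
  assumes "1 \<le> m"
  shows "L (act (loop u (- int m)) v)
    = act (loop u (- int m)) (L v) + vscale (of_nat m) (act (loop u (- int m)) v)"
proof -
  have "(\<Sum>e\<in>E. vscale (2 * (of_nat m * form u e)) (act (loop e (- int m)) v))
      = vscale (2 * of_nat m) (act (loop (\<Sum>e\<in>E. scale (form u e) e) (- int m)) v)"
    by (simp add: mode_sum mode_scale V.scale_sum_right mult.assoc)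
  also have "\<dots> = vscale (2 * of_nat m) (act (loop u (- int m)) v)"
    by (simp add: H.basis_expansion[OF basis])
  finally show ?thesis
    by (simp add: L_eq quadratic_mode_commute[OF assms] sum.distrib V.scale_right_distrib
        act_scale act_sum)
qed

text \<open>
  The vectors \<open>u\<^sub>1(-m\<^sub>1) \<dots> u\<^sub>r(-m\<^sub>r)vac\<close> with all \<open>m\<^sub>i \<ge> 1\<close>, graded by \<open>n = m\<^sub>1 + \<dots> + m\<^sub>r\<close>.
\<close>

inductive creation_word :: "nat \<Rightarrow> 'v \<Rightarrow> bool" where
  vac: "creation_word 0 vac"
| mode: "creation_word n v \<Longrightarrow> 1 \<le> m \<Longrightarrow> creation_word (n + m) (act (loop u (- int m)) v)"

lemma L_creation_word: "creation_word n v \<Longrightarrow> L v = vscale (of_nat n) v"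
proof (induction rule: creation_word.induct)
  case (mode n v m u)
  then show ?case by (simp add: L_commute act_scale V.scale_left_distrib)
qed (simp add: L_vac)

lemma creation_word_one: "creation_word 1 v \<Longrightarrow> \<exists>u. v = state u"
proof (erule creation_word.cases)
  fix n w m u assume *: "1 = n + m" "v = act (loop u (- int m)) w" "creation_word n w" "1 \<le> m"
  then have "n = 0" "m = 1" by auto
  moreover from this * have "w = vac" by (auto elim: creation_word.cases)
  ultimately show ?thesis using * by (auto simp: state_def)
qed simp

text \<open>
  The span is stable under all modes: annihilation modes are commuted to the right until they kill
  the vacuum.
\<close>

lemma creation_words_span: "v \<in> V.span {v. \<exists>n. creation_word n v}" (is "_ \<in> V.span ?C")
proof (rule mode_induct)
  show "vac \<in> V.span ?C" by (intro V.span_base CollectI exI[of _ 0] creation_word.vac)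
  have neg: "act (loop u (- int m)) v \<in> V.span ?C" if "v \<in> V.span ?C" "1 \<le> m" for u m v
    using that(1)
  proof (induction rule: V.span_induct)
    case base
    show ?case by (auto simp: V.subspace_def act_add act_scale V.span_add V.span_scale V.span_zero)
  next
    case (step w)
    then obtain n where "creation_word n w" by auto
    from creation_word.mode[OF this that(2)] show ?case by (blast intro: V.span_base)
  qed
  have pos: "act (loop u n) v \<in> V.span ?C" if "v \<in> V.span ?C" "0 < n" for u n v
    using that(1)
  proof (induction rule: V.span_induct)
    case base
    show ?case by (auto simp: V.subspace_def act_add act_scale V.span_add V.span_scale V.span_zero)
  next
    case (step w)
    then obtain k where "creation_word k w" by auto
    then show ?case
    proof (induction rule: creation_word.induct)
      case vac
      show ?case using mode_vac[of n u] that(2) by (simp add: V.span_zero)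
    next
      case (mode k w m u')
      then have "w \<in> V.span ?C" by (intro V.span_base) auto
      then have "(if n + - int m = 0 then vscale (of_int n * form u u') w else 0) \<in> V.span ?C"
        by (auto intro: V.span_scale V.span_zero)
      moreover have "act (loop u' (- int m)) (act (loop u n) w) \<in> V.span ?C"
        using neg mode by blast
      ultimately show ?case by (subst mode_commute) (rule V.span_add)
    qed
  qed
  show "act (loop u n) v \<in> V.span ?C" if "v \<in> V.span ?C" for u n v
  proof (cases n "0::int" rule: linorder_cases)
    case less
    then show ?thesis using neg[OF that, of "nat (- n)" u] by simp
  next
    case equal
    then show ?thesis by (simp add: mode_zero V.span_zero)
  next
    case greater
    then show ?thesis using pos that by simp
  qed
qed (rule V.subspace_span)

text \<open>
  The operator \<open>\<Prod>\<^sub>i (L - n\<^sub>i)\<close>. It annihilates a sum of eigenvectors once their eigenvalues are among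
  the \<open>n\<^sub>i\<close>, and acts on an eigenvector for the eigenvalue 1 as \<open>\<Prod>\<^sub>i (1 - n\<^sub>i)\<close>; so it separates the weight 1
  from the others.
\<close>

definition shifted_product :: "complex list \<Rightarrow> 'v \<Rightarrow> 'v" where
  "shifted_product ns = foldr (\<lambda>n v. L v - vscale n v) ns"

lemma shifted_product_simps:
  "shifted_product [] v = v"
  "shifted_product (n # ns) v = L (shifted_product ns v) - vscale n (shifted_product ns v)"
  by (simp_all add: shifted_product_def)

lemma shifted_product_add: "shifted_product ns (v + w) = shifted_product ns v + shifted_product ns w"
  by (induction ns) (simp_all add: shifted_product_simps L_add V.scale_right_distrib)

lemma shifted_product_scale: "shifted_product ns (vscale c v) = vscale c (shifted_product ns v)"
  by (induction ns) (simp_all add: shifted_product_simps L_scale V.scale_right_diff_distrib mult.commute)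

lemma shifted_product_L: "shifted_product ns (L v) = L (shifted_product ns v)"
  by (induction ns) (simp_all add: shifted_product_simps L_diff L_scale)

lemma shifted_product_zero: "shifted_product ns 0 = 0"
  using shifted_product_scale[of ns 0 0] by simp

lemma shifted_product_diff: "shifted_product ns (v - w) = shifted_product ns v - shifted_product ns w"
  using shifted_product_add[of ns "v - w" w] by simp

lemma shifted_product_append: "shifted_product (ns @ ms) v = shifted_product ns (shifted_product ms v)"
  by (induction ns) (simp_all add: shifted_product_simps)

lemma shifted_product_commute:
  "shifted_product ns (shifted_product ms v) = shifted_product ms (shifted_product ns v)"
  by (induction ns arbitrary: v)
    (simp_all add: shifted_product_simps shifted_product_diff shifted_product_L shifted_product_scale)

lemma shifted_product_eigenvector:
  assumes "L v = v"
  shows "shifted_product ns v = vscale (prod_list (map (\<lambda>n. 1 - n) ns)) v"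
  by (induction ns)
    (simp_all add: shifted_product_simps L_scale assms V.scale_left_diff_distrib mult.commute algebra_simps)

text \<open>
  Creation words of weight 1 are the vectors \<open>u(-1)vac\<close>, and those of weight \<open>n \<noteq> 1\<close> are killed by
  \<open>L - n\<close>. Sums of the latter are killed by the product of the operators for the summands, because
  these operators commute.
\<close>

lemma weight_one_decomp: "\<exists>u w ns. v = state u + w \<and> 1 \<notin> set ns \<and> shifted_product ns w = 0"
proof -
  let ?S = "{v. \<exists>u w ns. v = state u + w \<and> 1 \<notin> set ns \<and> shifted_product ns w = 0}"
  have "V.span {v. \<exists>n. creation_word n v} \<subseteq> ?S"
  proof (rule V.span_minimal)
    show "{v. \<exists>n. creation_word n v} \<subseteq> ?S"
    proof clarify
      fix v n assume cw: "creation_word n v"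
      show "\<exists>u w ns. v = state u + w \<and> 1 \<notin> set ns \<and> shifted_product ns w = 0"
      proof (cases "n = 1")
        case True
        with creation_word_one cw obtain u where "v = state u" by auto
        then show ?thesis by (intro exI[of _ u] exI[of _ 0] exI[of _ "[]"]) (simp add: shifted_product_simps)
      next
        case False
        have "state 0 = 0" using state_scale[of 0 0] by simp
        then show ?thesis using L_creation_word[OF cw] False
          by (intro exI[of _ 0] exI[of _ v] exI[of _ "[of_nat n]"]) (auto simp: shifted_product_simps of_nat_eq_1_iff)
      qed
    qed
    show "V.subspace ?S"
      unfolding V.subspace_def
    proof (intro conjI ballI allI)
      have "state 0 = 0" using state_scale[of 0 0] by simp
      then show "0 \<in> ?S" by (intro CollectI exI[of _ 0] exI[of _ 0] exI[of _ "[]"]) (simp add: shifted_product_simps)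
    next
      fix x y assume "x \<in> ?S" "y \<in> ?S"
      then obtain u w ns u' w' ns' where
        "x = state u + w" "1 \<notin> set ns" "shifted_product ns w = 0"
        "y = state u' + w'" "1 \<notin> set ns'" "shifted_product ns' w' = 0" by blast
      moreover from this have "shifted_product (ns @ ns') (w + w') = 0"
        using shifted_product_commute[of ns ns' w]
        by (simp add: shifted_product_append shifted_product_add shifted_product_zero)
      ultimately show "x + y \<in> ?S"
        by (intro CollectI exI[of _ "u + u'"] exI[of _ "w + w'"] exI[of _ "ns @ ns'"])
          (auto simp: state_add)
    next
      fix c x assume "x \<in> ?S"
      then obtain u w ns where "x = state u + w" "1 \<notin> set ns" "shifted_product ns w = 0" by blast
      then show "vscale c x \<in> ?S"
        by (intro CollectI exI[of _ "scale c u"] exI[of _ "vscale c w"] exI[of _ ns])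
          (auto simp: state_scale V.scale_right_distrib shifted_product_scale)
    qed
  qed
  then show ?thesis using creation_words_span by blast
qed

lemma L_state: "L (state u) = state u"
  using L_commute[of 1 u vac] by (simp add: state_def L_vac)

text \<open>
  In the decomposition \<open>v = u(-1)vac + w\<close> of \<open>weight_one_decomp\<close> the remainder \<open>w\<close> is again fixed by \<open>L\<close>,
  and a product \<open>\<Prod>\<^sub>i (L - n\<^sub>i)\<close> with all \<open>n\<^sub>i \<noteq> 1\<close> kills it. This product multiplies \<open>w\<close> by a non-zero
  scalar, so \<open>w = 0\<close>.
\<close>

lemma weight_one_space: "L v = v \<longleftrightarrow> v \<in> range state"
proof
  assume v: "L v = v"
  obtain u w ns where *: "v = state u + w" "1 \<notin> set ns" "shifted_product ns w = 0"
    using weight_one_decomp by blast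
  have "L w = w" using v by (simp add: *(1) L_add L_state)
  then have "vscale (prod_list (map (\<lambda>n. 1 - n) ns)) w = 0"
    using shifted_product_eigenvector *(3) by simp
  moreover have "prod_list (map (\<lambda>n. 1 - n) ns) \<noteq> 0" using *(2) by (induction ns) auto
  ultimately have "w = 0" by simp
  then show "v \<in> range state" using * by simp
qed (auto simp: L_state)

end

lemma additive_sum:
  fixes g :: "'a::ab_group_add \<Rightarrow> 'b::ab_group_add"
  assumes add: "\<And>v w. g (v + w) = g v + g w"
  shows "g (\<Sum>i\<in>I. f i) = (\<Sum>i\<in>I. g (f i))"
proof -
  have "g 0 = 0" using add[of 0 0] by simp
  then show ?thesis by (induction I rule: infinite_finite_induct) (auto simp: add)
qed

section \<open>Automorphisms and isometries\<close>

context heisenberg_conformal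
begin

abbreviation restriction :: "('v \<Rightarrow> 'v) \<Rightarrow> 'h \<Rightarrow> 'h" where
  "restriction \<equiv> restrict_weight_one act vac"

lemma restriction_eqI: "g (state u) = state u' \<Longrightarrow> restriction g u = u'"
  unfolding restrict_weight_one_def state_def[symmetric]
  by (rule the_equality) (auto dest: state_inj)

lemma quadratic_positive_mode:
  assumes "2 \<le> n"
  shows "act (loop u n) (act (loop e (-1)) (state e)) = 0"
  using assms by (simp add: state_def mode_commute[of u n] mode_vac)

lemma mode_two_conf: "act (loop u 2) conf = vscale (2 * form u h) vac"
  by (simp add: conf_eq act_add act_scale act_sum quadratic_positive_mode mode_commute[of u 2 h] mode_vac)

text \<open>
  An automorphism fixing the conformal vector commutes with \<open>L\<close> and so permutes its fixed vectors
  \<open>u(-1)vac\<close>. The restriction is an isometry since \<open>\<langle>u,v\<rangle>\<close> is the coefficient of \<open>vac\<close> in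
  \<open>u(1)v(-1)vac\<close>, and it fixes \<open>h\<close> since \<open>\<langle>u,h\<rangle>\<close> is half the coefficient of \<open>vac\<close> in \<open>u(2)\<omega>\<close>.
\<close>

lemma automorphism_restriction:
  assumes g: "va_automorphism vscale vac Y g" "g conf = conf"
  shows "g (state u) = state (restriction g u)"
    and "H.isometry (restriction g)" and "restriction g h = h"
proof -
  have lin: "g (v + w) = g v + g w" "g (vscale c v) = vscale c (g v)" for v w c
    using g(1) by (auto simp: va_automorphism_def Vector_Spaces.linear_iff)
  have g': "bij g" "g vac = vac" "g (Y a n b) = Y (g a) n (g b)" for a n b
    using g(1) by (auto simp: va_automorphism_def)
  have inj: "g v = g w \<longleftrightarrow> v = w" for v w using g'(1) by (auto simp: bij_def inj_def)
  have L: "g (L v) = L (g v)" for v by (simp add: L_def g' g(2))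
  have state: "g (state u) = state (restriction g u)" for u
  proof -
    have "g (state u) \<in> range state" using L[of "state u"] by (simp add: L_state flip: weight_one_space)
    then obtain u' where "g (state u) = state u'" by blast
    then show ?thesis using restriction_eqI by metis
  qed
  then show "g (state u) = state (restriction g u)" .
  let ?s = "restriction g"
  have form: "form (?s u) (?s v) = form u v" for u v
  proof -
    have "vscale (form (?s u) (?s v)) vac = Y (state (?s u)) 1 (state (?s v))"
      by (simp add: state_modes state_pairing)
    also have "\<dots> = g (Y (state u) 1 (state v))" by (simp add: g' state)
    also have "\<dots> = vscale (form u v) vac" by (simp add: state_modes state_pairing lin g')
    finally show ?thesis by (rule vac_scale_cancel)
  qed
  have surj: "\<exists>u. ?s u = u'" for u'
  proof -
    obtain v where v: "g v = state u'" using g'(1) by (metis bij_pointE)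
    then have "g (L v) = g v" by (simp add: L L_state)
    then have "L v = v" by (simp add: inj)
    then obtain u where "v = state u" using weight_one_space by blast
    with v have "?s u = u'" by (intro restriction_eqI) simp
    then show ?thesis ..
  qed
  have "?s (u + v) = ?s u + ?s v" "?s (scale c u) = scale c (?s u)" for u v c
    by (rule restriction_eqI; simp add: state_add state_scale lin state)+
  moreover have "inj ?s"
    by (rule injI) (metis inj state state_inj)
  ultimately show "H.isometry ?s"
    using surj form H.vector_space_axioms
    unfolding H.isometry_def Vector_Spaces.linear_iff bij_def surj_def by metis
  have "form u h = form (?s u) h" for u
  proof -
    have "vscale (2 * form (?s u) h) vac = Y (state (?s u)) 2 conf"
      by (simp add: state_modes mode_two_conf)
    also have "\<dots> = g (Y (state u) 2 conf)" by (simp add: g' state g(2))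
    also have "\<dots> = vscale (2 * form u h) vac" by (simp add: state_modes mode_two_conf lin g')
    finally have "2 * form (?s u) h = 2 * form u h" by (rule vac_scale_cancel)
    then show ?thesis by simp
  qed
  then have "form (?s u) (?s h - h) = 0" for u by (simp add: H.form_diff_right form)
  then have "form (?s h - h) v = 0" for v using surj[of v] H.form_sym by metis
  then have "?s h - h = 0" by (rule H.form_nondegenerate)
  then show "?s h = h" by simp
qed

text \<open>
  The universal property of the induced module, for a second action on the same space for which the
  vacuum has the same character. Evaluating words with the second action kills all defining
  relations, hence factors through the first action.
\<close>

lemma induced_universal:
  fixes act' :: "'h heis \<Rightarrow> 'v \<Rightarrow> 'v"
  assumes lin: "\<And>x v w. act' x (v + w) = act' x v + act' x w"
      "\<And>x c v. act' x (vscale c v) = vscale c (act' x v)"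
      "\<And>x y v. act' (x + y) v = act' x v + act' y v"
      "\<And>x c v. act' (heis_scale scale c x) v = vscale c (act' x v)"
    and bracket: "\<And>x y v. act' (heis_bracket form x y) v = act' x (act' y v) - act' y (act' x v)"
    and vac: "\<And>x. x \<in> heis_nonneg \<Longrightarrow> act' x vac = vscale (snd x) vac"
  obtains g where "\<And>v w. g (v + w) = g v + g w" "\<And>c v. g (vscale c v) = vscale c (g v)"
    "g vac = vac" "\<And>x v. g (act x v) = act' x (g v)"
proof -
  define A where "A = CV.free_extend (\<lambda>xs. foldr act' xs vac)"
  let ?W = "word_action vscale act vac"
  have diff: "act' x (v - w) = act' x v - act' x w" for x v w
    using lin(1)[of x "v - w" w] by simp
  have foldr: "foldr act' xs (v + w) = foldr act' xs v + foldr act' xs w"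
    "foldr act' xs (v - w) = foldr act' xs v - foldr act' xs w"
    "foldr act' xs (vscale c v) = vscale c (foldr act' xs v)" for xs v w c
    by (induction xs) (auto simp: lin diff)
  have right: "foldr act' ps vac = vscale (prod_list (map snd ps)) vac" if "set ps \<subseteq> heis_nonneg" for ps
    using that by (induction ps) (auto simp: lin vac mult.commute)
  have A0: "A p = 0" if "?W p = 0" for p
    unfolding A_def
  proof (rule CV.free_extend_span_zero)
    show "p \<in> free_alg.span (uea_relations (heis_scale scale) (heis_bracket form)
        \<union> tensor_relations heis_nonneg snd)"
      using that by (simp add: kernel)
    fix r assume "r \<in> uea_relations (heis_scale scale) (heis_bracket form)
        \<union> tensor_relations heis_nonneg snd"
    then consider xs x y ys where
        "r = word (xs @ [x + y] @ ys) - word (xs @ [x] @ ys) - word (xs @ [y] @ ys)"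
      | xs c x ys where
        "r = word (xs @ [heis_scale scale c x] @ ys) - free_scale c (word (xs @ [x] @ ys))"
      | xs x y ys where "r = word (xs @ [x, y] @ ys) - word (xs @ [y, x] @ ys)
          - word (xs @ [heis_bracket form x y] @ ys)"
      | us ps where "r = word (us @ ps) - free_scale (prod_list (map snd ps)) (word us)"
          "set ps \<subseteq> heis_nonneg"
      unfolding uea_relations_def tensor_relations_def by blast
    then show "CV.free_extend (\<lambda>xs. foldr act' xs vac) r = 0"
      by cases (simp_all only: CV.free_extend_simps foldr_append foldr.simps comp_apply lin bracket
          foldr right, simp_all)
  qed
  define g where "g v = A (SOME p. ?W p = v)" for v
  have surj: "\<exists>p. ?W p = v" for v using induced by (metis induced_module_def surjD)
  have gW: "g (?W p) = A p" for p
  proof -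
    let ?q = "SOME q. ?W q = ?W p"
    have "?W ?q = ?W p" by (rule someI[of _ p]) simp
    then have "?W (?q - p) = 0" by (simp add: word_action_eq CV.free_extend_diff)
    from A0[OF this] show ?thesis by (simp add: g_def A_def CV.free_extend_diff)
  qed
  have g_add: "g (v + w) = g v + g w" for v w
  proof -
    obtain p q where "v = ?W p" "w = ?W q" using surj by metis
    then show ?thesis using gW[of "p + q"] gW[of p] gW[of q]
      by (simp add: word_action_eq A_def CV.free_extend_add)
  qed
  have g_scale: "g (vscale c v) = vscale c (g v)" for c v
  proof -
    obtain p where "v = ?W p" using surj by metis
    then show ?thesis using gW[of "free_scale c p"] gW[of p]
      by (simp add: word_action_eq A_def CV.free_extend_scale)
  qed
  have g_word: "g (foldr act xs vac) = foldr act' xs vac" for xs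
    using gW[of "word xs"] by (simp add: word_action_eq A_def CV.free_extend_word)
  have "g (act x v) = act' x (g v)" for x v
  proof -
    have "v \<in> V.span (range (\<lambda>xs. foldr act xs vac))" by (rule words_span)
    then show ?thesis
    proof (induction rule: V.span_induct)
      case base
      have "g 0 = 0" using g_scale[of 0 0] by simp
      moreover have "act' x 0 = 0" using lin(2)[of x 0 0] by simp
      ultimately show ?case by (auto simp: V.subspace_def act_add act_scale g_add g_scale lin)
    next
      case (step w)
      then obtain xs where "w = foldr act xs vac" by auto
      then show ?case using g_word[of xs] g_word[of "x # xs"] by simp
    qed
  qed
  moreover have "g vac = vac" using g_word[of "[]"] by simp
  ultimately show ?thesis using that g_add g_scale by blast
qed

definition heis_map :: "('h \<Rightarrow> 'h) \<Rightarrow> 'h heis \<Rightarrow> 'h heis" where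
  "heis_map \<sigma> x = (Poly_Mapping.map \<sigma> (fst x), snd x)"

context
  fixes \<sigma> assumes \<sigma>: "H.isometry \<sigma>"
begin

lemma lookup_heis_map:
  "Poly_Mapping.lookup (fst (heis_map \<sigma> x)) n = \<sigma> (Poly_Mapping.lookup (fst x) n)"
  by (simp add: heis_map_def Poly_Mapping.map.rep_eq when_def H.isometry_simps[OF \<sigma>])

lemma heis_eqI:
  "(\<And>n. Poly_Mapping.lookup (fst x) n = Poly_Mapping.lookup (fst y) n) \<Longrightarrow> snd x = snd y \<Longrightarrow> x = (y :: 'h heis)"
  by (intro prod_eqI poly_mapping_eqI) auto

lemma snd_heis_map: "snd (heis_map \<sigma> x) = snd x"
  by (simp add: heis_map_def)

lemma heis_map_add: "heis_map \<sigma> (x + y) = heis_map \<sigma> x + heis_map \<sigma> y"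
  by (rule heis_eqI) (simp_all add: lookup_heis_map snd_heis_map lookup_add H.isometry_simps[OF \<sigma>])

lemma heis_map_scale: "heis_map \<sigma> (heis_scale scale c x) = heis_scale scale c (heis_map \<sigma> x)"
  by (rule heis_eqI)
    (simp_all add: lookup_heis_map snd_heis_map H.lookup_heis_scale H.isometry_simps[OF \<sigma>],
      simp add: heis_scale_def snd_heis_map)

lemma heis_map_bracket:
  "heis_map \<sigma> (heis_bracket form x y) = heis_bracket form (heis_map \<sigma> x) (heis_map \<sigma> y)"
proof -
  have "Poly_Mapping.keys (fst (heis_map \<sigma> x)) = Poly_Mapping.keys (fst x)"
    using H.isometry_simps(4,6)[OF \<sigma>] by (auto simp: in_keys_iff lookup_heis_map) metis+
  then have "heis_bracket form (heis_map \<sigma> x) (heis_map \<sigma> y) = heis_bracket form x y"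
    by (simp add: heis_bracket_def lookup_heis_map H.isometry_simps[OF \<sigma>])
  moreover have "heis_map \<sigma> (heis_bracket form x y) = heis_bracket form x y"
    by (rule heis_eqI)
      (simp_all add: lookup_heis_map snd_heis_map heis_bracket_def H.isometry_simps[OF \<sigma>])
  ultimately show ?thesis by simp
qed

lemma heis_map_loop: "heis_map \<sigma> (loop u n) = loop (\<sigma> u) n"
  by (rule heis_eqI)
    (simp_all add: lookup_heis_map snd_heis_map,
      simp_all add: loop_def lookup_single when_def H.isometry_simps[OF \<sigma>])

lemma heis_map_lift:
  obtains g where "\<And>v w. g (v + w) = g v + g w" "\<And>c v. g (vscale c v) = vscale c (g v)"
    "g vac = vac" "\<And>x v. g (act x v) = act (heis_map \<sigma> x) (g v)"
proof (rule induced_universal[of "\<lambda>x. act (heis_map \<sigma> x)"])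
  show "act (heis_map \<sigma> x) vac = vscale (snd x) vac" if "x \<in> heis_nonneg" for x
  proof -
    have "heis_map \<sigma> x \<in> heis_nonneg"
      using that by (simp add: heis_nonneg_def lookup_heis_map H.isometry_simps[OF \<sigma>])
    then show ?thesis by (simp add: act_vac snd_heis_map)
  qed
qed (simp_all add: act_add act_scale act_plus act_heis_scale act_bracket heis_map_add heis_map_scale
    heis_map_bracket, blast intro: that)

end

text \<open>
  The lift \<open>g\<close> exists by \<open>heis_map_lift\<close>, and the lift of the inverse isometry is its inverse. The
  vectors \<open>a\<close> with \<open>g (a\<^sub>n b) = (g a)\<^sub>n (g b)\<close> for all \<open>n\<close>, \<open>b\<close> contain \<open>vac\<close> and, by the iterate formula,
  are closed under all modes \<open>u(n)\<close>, so they are everything. Finally \<open>\<Sum>\<^sub>e e(-1)\<^sup>2vac\<close> is the same for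
  every orthonormal basis.
\<close>

lemma isometry_lift:
  assumes \<sigma>: "H.isometry \<sigma>" and h: "\<sigma> h = h"
  obtains g where "va_automorphism vscale vac Y g" "g conf = conf" "\<And>u. g (state u) = state (\<sigma> u)"
proof -
  obtain g where g: "\<And>v w. g (v + w) = g v + g w" "\<And>c v. g (vscale c v) = vscale c (g v)"
    "g vac = vac" "\<And>x v. g (act x v) = act (heis_map \<sigma> x) (g v)"
    using heis_map_lift[OF \<sigma>] by blast
  have g_mode: "g (act (loop u n) v) = act (loop (\<sigma> u) n) (g v)" for u n v
    by (simp add: g heis_map_loop[OF \<sigma>])
  have g_state: "g (state u) = state (\<sigma> u)" for u by (simp add: state_def g_mode g(3))
  have g_diff: "g (v - w) = g v - g w" for v w using g(1)[of "v - w" w] by simp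
  have g_zero: "g 0 = 0" using g_diff[of 0 0] by simp
  note g_sum = additive_sum[of g, OF g(1)]

  define \<tau> where "\<tau> = inv_into UNIV \<sigma>"
  have b: "bij \<sigma>" using \<sigma> by (simp add: H.isometry_def)
  have inverse: "\<tau> (\<sigma> u) = u" "\<sigma> (\<tau> u) = u" for u
    using b by (simp_all add: \<tau>_def bij_is_inj bij_is_surj surj_f_inv_f)
  have "\<tau> (u + v) = \<tau> u + \<tau> v" "\<tau> (scale c u) = scale c (\<tau> u)"
    "form (\<tau> u) (\<tau> v) = form u v" for u v c
    using H.isometry_simps[OF \<sigma>] inverse by metis+
  moreover have "bij \<tau>" using b by (simp add: \<tau>_def bij_imp_bij_inv)
  ultimately have \<tau>: "H.isometry \<tau>"
    using H.vector_space_axioms by (simp add: H.isometry_def Vector_Spaces.linear_iff)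
  obtain k where k: "\<And>v w. k (v + w) = k v + k w" "\<And>c v. k (vscale c v) = vscale c (k v)"
    "k vac = vac" "\<And>x v. k (act x v) = act (heis_map \<tau> x) (k v)"
    using heis_map_lift[OF \<tau>] by blast
  have k_mode: "k (act (loop u n) v) = act (loop (\<tau> u) n) (k v)" for u n v
    by (simp add: k heis_map_loop[OF \<tau>])
  have k0: "k 0 = 0" using k(2)[of 0 0] by simp
  have "v \<in> {v. k (g v) = v \<and> g (k v) = v}" for v
    by (rule mode_induct) (auto simp: V.subspace_def g(1-3) k(1-3) g_zero k0 g_mode k_mode inverse)
  then have bij: "bij g" by (intro o_bij[of k]) (auto simp: fun_eq_iff)

  have "v \<in> {a. \<forall>n b. g (Y a n b) = Y (g a) n (g b)}" (is "_ \<in> ?S") for v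
  proof (rule mode_induct)
    show "V.subspace ?S"
      by (auto simp: V.subspace_def g g_zero Y_add_left Y_scale_left)
    show "vac \<in> ?S" by (simp add: g V.vacuum g_zero)
    fix u n b assume b: "b \<in> ?S"
    have "g (Y (Y (state u) n b) k c) = Y (g (Y (state u) n b)) k (g c)" for k c
    proof -
      obtain N1 where N1: "\<And>N. N1 \<le> N \<Longrightarrow> Y (Y (state u) n b) k c =
          (\<Sum>i<N. vscale ((-1) ^ i * (of_int n gchoose i))
            (Y (state u) (n - int i) (Y b (k + int i) c)
             - vscale ((-1) powi n) (Y b (n + k - int i) (Y (state u) (int i) c))))"
        using iterate_formula[of "state u" n b k c] by blast
      obtain N2 where N2: "\<And>N. N2 \<le> N \<Longrightarrow> Y (Y (state (\<sigma> u)) n (g b)) k (g c) =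
          (\<Sum>i<N. vscale ((-1) ^ i * (of_int n gchoose i))
            (Y (state (\<sigma> u)) (n - int i) (Y (g b) (k + int i) (g c))
             - vscale ((-1) powi n) (Y (g b) (n + k - int i) (Y (state (\<sigma> u)) (int i) (g c)))))"
        using iterate_formula[of "state (\<sigma> u)" n "g b" k "g c"] by blast
      have bb: "g (Y b m w) = Y (g b) m (g w)" for m w using b by blast
      show ?thesis
        using N1[of "max N1 N2"] N2[of "max N1 N2"] g(1-3) bb g_diff
        by (simp add: g_sum state_modes g_mode)
    qed
    then show "act (loop u n) b \<in> ?S" by (simp add: state_modes)
  qed
  then have hom: "g (Y a n b) = Y (g a) n (g b)" for a n b by blast
  have "va_automorphism vscale vac Y g"
    using g bij hom V.vector_space_axioms by (simp add: va_automorphism_def Vector_Spaces.linear_iff)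

  moreover have "g conf = conf"
  proof -
    have "(\<Sum>e\<in>E. act (loop (\<sigma> e) (-1)) (state (\<sigma> e)))
        = (\<Sum>e\<in>E. \<Sum>f\<in>E. vscale (form (\<sigma> e) f) (act (loop (\<sigma> e) (-1)) (state f)))"
    proof (rule sum.cong[OF refl])
      fix e assume "e \<in> E"
      have "state (\<sigma> e) = state (\<Sum>f\<in>E. scale (form (\<sigma> e) f) f)"
        by (simp add: H.basis_expansion[OF basis])
      also have "\<dots> = (\<Sum>f\<in>E. vscale (form (\<sigma> e) f) (state f))"
        by (simp add: state_def mode_sum mode_scale)
      finally show "act (loop (\<sigma> e) (-1)) (state (\<sigma> e))
          = (\<Sum>f\<in>E. vscale (form (\<sigma> e) f) (act (loop (\<sigma> e) (-1)) (state f)))"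
        by (simp add: act_sum act_scale)
    qed
    also have "\<dots> = (\<Sum>f\<in>E. \<Sum>e\<in>E. vscale (form (\<sigma> e) f) (act (loop (\<sigma> e) (-1)) (state f)))"
      by (rule sum.swap)
    also have "\<dots> = (\<Sum>f\<in>E. act (loop (\<Sum>e\<in>E. scale (form (\<sigma> e) f) (\<sigma> e)) (-1)) (state f))"
      by (simp add: mode_sum mode_scale)
    also have "\<dots> = (\<Sum>f\<in>E. act (loop f (-1)) (state f))"
    proof (rule sum.cong[OF refl])
      fix f assume "f \<in> E"
      have "(\<Sum>e\<in>I. scale (a e) (\<sigma> e)) = \<sigma> (\<Sum>e\<in>I. scale (a e) e)" for I a
        by (induction I rule: infinite_finite_induct) (auto simp: H.isometry_simps[OF \<sigma>])
      then have "(\<Sum>e\<in>E. scale (form (\<sigma> e) f) (\<sigma> e)) = \<sigma> (\<Sum>e\<in>E. scale (form (\<tau> f) e) e)"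
        using H.isometry_simps(3)[OF \<sigma>, of _ "\<tau> f"] inverse(2) H.form_sym by simp
      also have "\<dots> = f" by (simp add: H.basis_expansion[OF basis] inverse)
      finally show "act (loop (\<Sum>e\<in>E. scale (form (\<sigma> e) f) (\<sigma> e)) (-1)) (state f) = act (loop f (-1)) (state f)"
        by simp
    qed
    finally show ?thesis by (simp add: conf_eq g(1-3) g_sum g_mode g_state h)
  qed
  ultimately show ?thesis using that g_state by blast
qed

theorem restriction_image:
  "restriction ` carrier (Aut_group vscale vac Y conf) = {\<sigma>. H.isometry \<sigma> \<and> \<sigma> h = h}"
proof (intro equalityI subsetI)
  fix \<sigma> assume "\<sigma> \<in> {\<sigma>. H.isometry \<sigma> \<and> \<sigma> h = h}"
  then obtain g where g: "va_automorphism vscale vac Y g" "g conf = conf" "\<And>u. g (state u) = state (\<sigma> u)"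
    using isometry_lift by blast
  have "restriction g = \<sigma>" using restriction_eqI[of g] g(3) by blast
  with g show "\<sigma> \<in> restriction ` carrier (Aut_group vscale vac Y conf)"
    by (auto simp: Aut_group_def)
qed (use automorphism_restriction in \<open>auto simp: Aut_group_def\<close>)

lemma orbit_eq:
  "orbit (Aut_group vscale vac Y conf) (Reg_action act vac) x
     = {(\<sigma> ` fst x, \<sigma> (snd x)) | \<sigma>. H.isometry \<sigma> \<and> \<sigma> h = h}"
proof -
  have "orbit (Aut_group vscale vac Y conf) (Reg_action act vac) x
      = (\<lambda>\<sigma>. (\<sigma> ` fst x, \<sigma> (snd x))) ` restriction ` carrier (Aut_group vscale vac Y conf)"
    by (auto simp: orbit_def Reg_action_def case_prod_beta image_image)
  also have "\<dots> = {(\<sigma> ` fst x, \<sigma> (snd x)) | \<sigma>. H.isometry \<sigma> \<and> \<sigma> h = h}"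
    unfolding restriction_image by auto
  finally show ?thesis .
qed

end

theorem theorem1p5:
  fixes scale :: "complex \<Rightarrow> 'h::ab_group_add \<Rightarrow> 'h"
    and form :: "'h \<Rightarrow> 'h \<Rightarrow> complex"
    and d :: nat
    and h :: 'h
    and E :: "'h set"
    and vscale :: "complex \<Rightarrow> 'v::ab_group_add \<Rightarrow> 'v"
    and act :: "'h heis \<Rightarrow> 'v \<Rightarrow> 'v"
    and vac :: 'v
    and Y :: "'v \<Rightarrow> int \<Rightarrow> 'v \<Rightarrow> 'v"
    and G :: "('v \<Rightarrow> 'v) monoid"
  assumes "quadratic_space scale form"
    and "vector_space.dim scale (UNIV :: 'h set) = d"
    and "h \<noteq> 0" and "form h h = 0"
    and "heisenberg_vertex_algebra scale form vscale act vac Y"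
    and "orthonormal_basis scale form E"
    and "G = Aut_group vscale vac Y (omega vscale act vac E h)"
  shows "orbits G (Reg scale form h) (Reg_action act vac) =
           {J1 scale form h k | k. k \<in> {2..d}} \<union>
           {J2 scale form h k | k. k \<in> {0..d - 2}} \<union>
           {J3 scale form h k y | k y. k \<in> {1..d - 1} \<and> y \<noteq> 0} \<union>
           {J4 scale form h k | k. k \<in> {2..d - 2}}
       \<and> Reg scale form h =
           (\<Union>k\<in>{2..d}. J1 scale form h k) \<union>
           (\<Union>k\<in>{0..d - 2}. J2 scale form h k) \<union>
           (\<Union>k\<in>{1..d - 1}. \<Union>y\<in>{y. y \<noteq> 0}. J3 scale form h k y) \<union>
           (\<Union>k\<in>{2..d - 2}. J4 scale form h k)"
proof -
  interpret heisenberg_conformal scale form vscale vac Y act E h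
    using assms
    by (intro heisenberg_conformal.intro heisenberg_va.intro heisenberg_conformal_axioms.intro
        heisenberg_va_axioms.intro) (simp_all add: heisenberg_vertex_algebra_def)
  have "orbits G (Reg scale form h) (Reg_action act vac)
      = {{(\<sigma> ` fst x, \<sigma> (snd x)) | \<sigma>. H.isometry \<sigma> \<and> \<sigma> h = h} | x. x \<in> Reg scale form h}"
    by (simp add: orbits_def orbit_eq assms(7) flip: conf_def)
  then show ?thesis using H.isometry_orbits[OF assms(3,4)] unfolding assms(2) by (intro conjI) simp_all
qed

end
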